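(* With $a=\sqrt{1+\sqrt 2}$, the following evaluations hold: $$A_{4,2}=1+\sqrt{1+\sqrt 2},$$ $$A_{4,3}=\frac{(1+\sqrt{2})(1+\sqrt{3})}{\sqrt 2},$$ $$A_{4,4}=\sqrt{8+6\sqrt 2}+\sqrt{6+4\sqrt 2},$$ $$A_{4,7}=\frac{(3+\sqrt 7)(4+\sqrt{14})}{2},$$ $$A_{4,8}=\sqrt{52+36\sqrt 2+(32+24\sqrt2)a}+\sqrt{56+40\sqrt 2+(36+26\sqrt2)a},$$ $$A_{4,9}=\sqrt{94+66\sqrt 2+38\sqrt 6+54\sqrt 3}+\sqrt{93+66\sqrt 2+38\sqrt 6+54\sqrt 3},$$ $$A_{4,12}=\sqrt{402+232\sqrt3+284\sqrt2+164\sqrt 6}+\sqrt{416+240\sqrt3 +294\sqrt2+170\sqrt6},$$ $$A_{4,28}=\sqrt{2(64641+17276\sqrt {14}+24432\sqrt7+45708\sqrt2)}+2\sqrt{32384+22899\sqrt2+12240\sqrt 7+8655\sqrt {14}}.$$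
   Context: For $|q|<1$, let $\varphi(q)=\sum_{m=-\infty}^{\infty}q^{m^2}$ and $\psi(q)=\sum_{m=0}^{\infty}q^{m(m+1)/2}$. For positive real $k,n$ define $$A_{k,n}=\frac{\varphi(-q)}{2k^{1/4}q^{k/4}\psi(q^{2k})},\qquad q=e^{-\pi\sqrt{n/k}}.$$ *)

theory Defs
  imports "HOL-Analysis.Analysis"
begin

text \<open>Ramanujan's theta functions \<open>\<phi>\<close> and \<open>\<psi>\<close>. The series are meaningful for \<open>norm q < 1\<close>,
  where they converge absolutely; outside that disc the values are the library's defaults.\<close>

definition theta_phi :: "'a::real_normed_field \<Rightarrow> 'a" where
  "theta_phi q = (\<Sum>\<^sub>\<infinity>m\<in>(UNIV :: int set). q powi (m\<^sup>2))"

definition theta_psi :: "'a::real_normed_field \<Rightarrow> 'a" where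
  "theta_psi q = (\<Sum>m::nat. q ^ (m * (m + 1) div 2))"

text \<open>Intended for positive real \<open>k\<close> and \<open>n\<close>, so that \<open>0 < q < 1\<close> below.\<close>

definition A :: "real \<Rightarrow> real \<Rightarrow> real" where
  "A k n = (let q = exp (- pi * sqrt (n / k)) in
     theta_phi (- q) / (2 * k powr (1/4) * q powr (k/4) * theta_psi (q powr (2 * k))))"

end

theory Submission
  imports Defs "HOL-Real_Asymp.Real_Asymp"
begin

text \<open>
  With \<open>q = exp (- pi * s)\<close> and \<open>s = sqrt n / 2\<close> the quotient \<open>A 4 n\<close> is \<open>sqrt 2 * u / (1 - u)\<close>, where
  \<open>u = \<theta>\<^sub>4 / \<theta>\<^sub>3\<close>, and by the quadratic transformation it is determined by the complementary modulus
  \<open>k'\<close> with nome \<open>exp (- pi * sqrt n)\<close>. Inversion \<open>s \<mapsto> 1 / s\<close> exchanges \<open>\<theta>\<^sub>2 / \<theta>\<^sub>3\<close> and \<open>\<theta>\<^sub>4 / \<theta>\<^sub>3\<close>, so a modular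
  equation of degree \<open>d\<close> at \<open>s = 1 / sqrt d\<close> becomes an algebraic equation for \<open>k'\<close> with nome \<open>exp (- pi * sqrt d)\<close>.
  The equations of degrees 2, 3 and 7 come from counting lattice points of \<open>x\<^sup>2 + y\<^sup>2\<close>, \<open>x\<^sup>2 + 3 y\<^sup>2\<close> and
  \<open>x\<^sup>2 + 7 y\<^sup>2\<close>; for \<open>n = 9\<close> the one of degree 3 is applied at \<open>s = 1\<close>. Inversion is obtained by Polya's
  method: it is the limit of the evaluation, with \<open>l\<close>-th roots of unity, of the sum of the binomial
  coefficients \<open>2 * m choose (m + j * l)\<close> over all \<open>j\<close>, where \<open>l\<^sup>2 / m\<close> tends to \<open>pi * s\<close>.
\<close>

section \<open>Theta series and binary quadratic forms\<close>

definition theta :: "real \<Rightarrow> real" where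
  "theta s = theta_phi (exp (- (pi * s)))"

text \<open>The part of the series of \<open>theta s\<close> over the odd integers; the even ones contribute \<open>theta (4 * s)\<close>.
  In Jacobi's notation with nome \<open>exp (- pi * s)\<close> one has \<open>\<theta>\<^sub>3 = theta s\<close>,
  \<open>\<theta>\<^sub>2 = odd_theta (s / 4)\<close> and \<open>\<theta>\<^sub>4 = theta (4 * s) - odd_theta s\<close>.\<close>

definition odd_theta :: "real \<Rightarrow> real" where
  "odd_theta s = theta s - theta (4 * s)"

section \<open>Theta values as absolutely convergent sums over the integers\<close>

lemma has_sum_int_even:
  fixes f :: "int \<Rightarrow> real"
  assumes even: "\<And>m. f (- m) = f m" and pos: "((\<lambda>k::nat. f (int (Suc k))) has_sum T) UNIV"
  shows "(f has_sum (f 0 + 2 * T)) UNIV"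
proof -
  have 1: "(f has_sum T) {1..}"
    using pos by (subst (asm) has_sum_reindex_bij_witness[where i = "\<lambda>m. nat (m - 1)"
        and j = "\<lambda>k. int (Suc k)" and h = f and s' = T and T = "{1..}"]) auto
  have 2: "(f has_sum T) {..-1}"
    using 1 by (subst (asm) has_sum_reindex_bij_witness[where i = uminus
        and j = uminus and h = f and s' = T and T = "{..-1}"]) (auto simp: even)
  have "(f has_sum (f 0 + (T + T))) ({0} \<union> ({1..} \<union> {..-1}))"
    by (intro has_sum_Un_disjoint 1 2) (auto intro!: has_sum_finiteI)
  also have "{0} \<union> ({1..} \<union> {..-1}) = (UNIV :: int set)"
    by auto
  finally show ?thesis by simp
qed

lemma summable_gauss:
  assumes "s > 0"
  shows "summable (\<lambda>k. exp (- (pi * s * (real (Suc k))\<^sup>2)))"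
proof (rule summable_comparison_test)
  have "exp (- (pi * s * (real (Suc k))\<^sup>2)) \<le> exp (- (pi * s)) ^ k" for k
  proof -
    have "real k \<le> (real (Suc k))\<^sup>2"
      by (simp add: power2_eq_square algebra_simps)
    then have "pi * s * real k \<le> pi * s * (real (Suc k))\<^sup>2"
      using assms by (intro mult_left_mono) auto
    then show ?thesis
      by (simp flip: exp_of_nat_mult add: mult_ac)
  qed
  then show "\<exists>N. \<forall>n\<ge>N. norm (exp (- (pi * s * (real (Suc n))\<^sup>2))) \<le> exp (- (pi * s)) ^ n"
    by auto
  show "summable ((^) (exp (- (pi * s))))"
    using assms by (intro summable_geometric) auto
qed

lemma
  assumes "s > 0"
  shows has_sum_theta: "((\<lambda>m::int. exp (- (pi * s * (of_int m)\<^sup>2))) has_sum theta s) UNIV"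
    and theta_suminf: "theta s = 1 + 2 * (\<Sum>k. exp (- (pi * s * (real (Suc k))\<^sup>2)))"
proof -
  let ?f = "\<lambda>m::int. exp (- (pi * s * (of_int m)\<^sup>2))"
  have "((\<lambda>k. exp (- (pi * s * (real (Suc k))\<^sup>2))) has_sum
      (\<Sum>k. exp (- (pi * s * (real (Suc k))\<^sup>2)))) UNIV"
    using summable_gauss[OF assms] by (intro norm_summable_imp_has_sum) (auto simp: summable_sums)
  then have *: "(?f has_sum ?f 0 + 2 * (\<Sum>k. exp (- (pi * s * (real (Suc k))\<^sup>2)))) UNIV"
    by (intro has_sum_int_even) (auto simp del: of_nat_Suc)
  have "theta s = infsum ?f UNIV"
    unfolding theta_def theta_phi_def by (intro infsum_cong) (simp add: exp_power_int algebra_simps)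
  with infsumI[OF *] show eq: "theta s = 1 + 2 * (\<Sum>k. exp (- (pi * s * (real (Suc k))\<^sup>2)))"
    by simp
  with * show "(?f has_sum theta s) UNIV" by simp
qed

lemma theta_ge_1: "s > 0 \<Longrightarrow> theta s \<ge> 1"
  using theta_suminf[of s] suminf_nonneg[OF summable_gauss[of s]] by simp

lemma has_sum_theta_even:
  assumes "s > 0"
  shows "((\<lambda>m::int. exp (- (pi * s * (of_int m)\<^sup>2))) has_sum theta (4 * s)) {m. even m}"
  using has_sum_theta[OF mult_pos_pos[OF zero_less_numeral assms], of "num.Bit0 (num.Bit0 num.One)"]
  by (subst (asm) has_sum_reindex_bij_witness[where i = "\<lambda>m. m div 2"
      and j = "\<lambda>m. 2 * m" and T = "{m. even m}" and s' = "theta (4 * s)"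
      and h = "\<lambda>m::int. exp (- (pi * s * (of_int m)\<^sup>2))"])
     (auto simp: power2_eq_square algebra_simps)

lemma has_sum_theta_odd:
  assumes "s > 0"
  shows "((\<lambda>m::int. exp (- (pi * s * (of_int m)\<^sup>2))) has_sum odd_theta s) {m. odd m}"
proof -
  have "((\<lambda>m::int. exp (- (pi * s * (of_int m)\<^sup>2))) has_sum theta s - theta (4 * s)) (UNIV - {m. even m})"
    by (intro has_sum_Diff has_sum_theta has_sum_theta_even assms) auto
  also have "UNIV - {m. even m} = {m::int. odd m}" by auto
  finally show ?thesis by (simp add: odd_theta_def)
qed

text \<open>Since \<open>m^2\<close> has the parity of \<open>m\<close>, negating the nome flips
  exactly the odd terms of the series.\<close>

lemma theta_phi_minus:
  assumes "s > 0"
  shows "theta_phi (- exp (- (pi * s))) = theta (4 * s) - odd_theta s"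
proof -
  let ?g = "\<lambda>m::int. exp (- (pi * s * (of_int m)\<^sup>2))"
  let ?f = "\<lambda>m::int. (if even m then ?g m else - ?g m)"
  have "(?f has_sum theta (4 * s)) {m. even m}"
    using has_sum_theta_even[OF assms] by (rule has_sum_cong[THEN iffD1, rotated]) simp
  moreover have "(?f has_sum - odd_theta s) {m. odd m}"
    using has_sum_uminusI[OF has_sum_theta_odd[OF assms]]
    by (rule has_sum_cong[THEN iffD1, rotated]) simp
  ultimately have "(?f has_sum theta (4 * s) + - odd_theta s) ({m. even m} \<union> {m. odd m})"
    by (rule has_sum_Un_disjoint) auto
  also have "{m. even m} \<union> {m. odd m} = (UNIV :: int set)" by auto
  finally have "infsum ?f UNIV = theta (4 * s) - odd_theta s"
    by (simp add: infsumI)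
  moreover have "theta_phi (- exp (- (pi * s))) = infsum ?f UNIV"
    unfolding theta_phi_def
    by (intro infsum_cong) (auto simp: exp_power_int power_int_minus_left algebra_simps)
  ultimately show ?thesis by simp
qed

section \<open>Lattice sums of the forms x^2 + N y^2\<close>

text \<open>This is the summand of the double series for \<open>theta s * theta (N * s)\<close>.
  Identities between products of theta values become bijections of lattice points that scale the
  quadratic form.\<close>

definition form_weight :: "real \<Rightarrow> real \<Rightarrow> int \<times> int \<Rightarrow> real" where
  "form_weight s N = (\<lambda>(x, y). exp (- (pi * s * ((of_int x)\<^sup>2 + N * (of_int y)\<^sup>2))))"

lemma has_sum_form_weight_times:
  assumes "((\<lambda>m::int. exp (- (pi * s * (of_int m)\<^sup>2))) has_sum a) X"
    and "((\<lambda>m::int. exp (- (pi * (N * s) * (of_int m)\<^sup>2))) has_sum b) Y"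
  shows "(form_weight s N has_sum (a * b)) (X \<times> Y)"
proof -
  have eq: "form_weight s N (x, y) =
    exp (- (pi * s * (of_int x)\<^sup>2)) * exp (- (pi * (N * s) * (of_int y)\<^sup>2))" for x y
    by (simp add: form_weight_def algebra_simps flip: exp_add)
  have 1: "((\<lambda>y. form_weight s N (x, y)) has_sum exp (- (pi * s * (of_int x)\<^sup>2)) * b) Y" for x
    unfolding eq by (intro has_sum_cmult_right assms)
  have 2: "((\<lambda>x::int. exp (- (pi * s * (of_int x)\<^sup>2)) * b) has_sum a * b) X"
    by (intro has_sum_cmult_left assms)
  have "form_weight s N summable_on X \<times> Y"
    using 2 by (intro summable_on_SigmaI[OF 1]) (auto simp: eq summable_on_def)
  with 1 2 show ?thesis by (rule has_sum_SigmaI)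
qed

lemma has_sum_form_weight_even_sum:
  assumes "s > 0" "N > 0"
  shows "(form_weight s N has_sum
    (theta (4 * s) * theta (4 * (N * s)) + odd_theta s * odd_theta (N * s))) {(x, y). even (x + y)}"
proof -
  have "(form_weight s N has_sum
    (theta (4 * s) * theta (4 * (N * s)) + odd_theta s * odd_theta (N * s)))
    ({m. even m} \<times> {m. even m} \<union> {m. odd m} \<times> {m. odd m})"
    using assms by (intro has_sum_Un_disjoint has_sum_form_weight_times
        has_sum_theta_even has_sum_theta_odd) auto
  also have "{m. even m} \<times> {m. even m} \<union> {m. odd m} \<times> {m. odd m} = {(x::int, y::int). even (x + y)}"
    by auto
  finally show ?thesis .
qed

lemma has_sum_form_weight_odd_sum:
  assumes "s > 0" "N > 0"
  shows "(form_weight s N has_sum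
    (theta (4 * s) * odd_theta (N * s) + odd_theta s * theta (4 * (N * s)))) {(x, y). odd (x + y)}"
proof -
  have "(form_weight s N has_sum
    (theta (4 * s) * odd_theta (N * s) + odd_theta s * theta (4 * (N * s))))
    ({m. even m} \<times> {m. odd m} \<union> {m. odd m} \<times> {m. even m})"
    using assms by (intro has_sum_Un_disjoint has_sum_form_weight_times
        has_sum_theta_even has_sum_theta_odd) auto
  also have "{m. even m} \<times> {m. odd m} \<union> {m. odd m} \<times> {m. even m} = {(x::int, y::int). odd (x + y)}"
    by auto
  finally show ?thesis .
qed

text \<open>Each pair of odd integers satisfies exactly one of \<open>x \<equiv> y\<close> and \<open>x \<equiv> - y\<close> modulo 4.\<close>

lemma has_sum_form_weight_odd_pairs_cong:
  assumes "s > 0" "N > 0"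
  shows "(form_weight s N has_sum (odd_theta s * odd_theta (N * s) / 2))
    {(x, y). odd x \<and> odd y \<and> 4 dvd x - y}" (is "(_ has_sum _) ?P")
proof -
  let ?Q = "{(x::int, y::int). odd x \<and> odd y \<and> 4 dvd x + y}"
  have all: "(form_weight s N has_sum (odd_theta s * odd_theta (N * s))) ({m. odd m} \<times> {m. odd m})"
    using assms by (intro has_sum_form_weight_times has_sum_theta_odd) auto
  have "(4 dvd x - y) \<noteq> (4 dvd x + y)" if "odd x" "odd y" for x y :: int
    using that by presburger
  then have un: "{m. odd m} \<times> {m. odd m} = ?P \<union> ?Q" and disj: "?P \<inter> ?Q = {}"
    by blast+
  have "form_weight s N summable_on ?P"
    by (rule summable_on_subset_banach[OF has_sum_imp_summable[OF all]]) auto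
  then obtain S where S: "(form_weight s N has_sum S) ?P"
    by (auto simp: summable_on_def)
  moreover have "(form_weight s N has_sum S) ?Q"
    using S by (subst (asm) has_sum_reindex_bij_witness[where i = "\<lambda>(x, y). (x, - y)"
        and j = "\<lambda>(x, y). (x, - y)" and T = ?Q and s' = S and h = "form_weight s N"])
      (auto simp: form_weight_def)
  ultimately have "(form_weight s N has_sum (S + S)) (?P \<union> ?Q)"
    by (rule has_sum_Un_disjoint[OF _ _ disj])
  then have "S + S = odd_theta s * odd_theta (N * s)"
    using all unfolding un by (rule has_sum_unique)
  then have "S = odd_theta s * odd_theta (N * s) / 2" by simp
  with S show ?thesis by simp
qed

text \<open>The map (u, v) to (u + v, u - v) doubles u^2 + v^2, and its image consists of the pairs
  with even sum. Such pairs have both coordinates even or both odd, which gives the two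
  squares.\<close>

lemma theta_double:
  assumes "s > 0"
  shows "(theta (2 * s))\<^sup>2 = (theta (4 * s))\<^sup>2 + (odd_theta s)\<^sup>2"
proof -
  have "(form_weight (2 * s) 1 has_sum (theta (2 * s) * theta (2 * s))) (UNIV \<times> UNIV)"
    using assms has_sum_theta[of "2 * s"] by (intro has_sum_form_weight_times) auto
  then have "(form_weight s 1 has_sum (theta (2 * s) * theta (2 * s))) {(x, y). even (x + y)}"
  proof (subst (asm) has_sum_reindex_bij_witness[where
        i = "\<lambda>(x, y). ((x + y) div 2, (x - y) div 2)" and j = "\<lambda>(u, v). (u + v, u - v)"
        and T = "{(x, y). even (x + y)}" and s' = "theta (2 * s) * theta (2 * s)" and h = "form_weight s 1"])
    fix p :: "int \<times> int" assume "p \<in> {(x, y). even (x + y)}"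
    then obtain x y where [simp]: "p = (x, y)" and "even (x + y)"
      by auto
    then obtain k where "x + y = 2 * k"
      by (auto simp only: dvd_def)
    then have x: "x = 2 * k - y" by simp
    have d: "(x + y) div 2 = k" "(x - y) div 2 = k - y"
      using x by presburger+
    show "(\<lambda>(u, v). (u + v, u - v)) ((\<lambda>(x, y). ((x + y) div 2, (x - y) div 2)) p) = p"
      using d x by simp
  qed (auto simp: form_weight_def power2_eq_square algebra_simps)
  with has_sum_form_weight_even_sum[of s 1] assms show ?thesis
    by (auto dest: has_sum_unique simp: power2_eq_square)
qed

text \<open>The bijection is multiplication by a unit of the Eisenstein integers, up to conjugation: half of the elements
  \<open>(X + Y * sqrt (-3)) / 2\<close> with odd \<open>X\<close>, \<open>Y\<close> are carried to \<open>x + y * sqrt (-3)\<close> with \<open>x + y\<close> odd.\<close>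

lemma odd_theta_3:
  assumes "s > 0"
  shows "odd_theta s * odd_theta (3 * s) =
    2 * (theta (16 * s) * odd_theta (12 * s) + odd_theta (4 * s) * theta (48 * s))"
proof -
  let ?S = "theta (4 * (4 * s)) * odd_theta (3 * (4 * s)) + odd_theta (4 * s) * theta (4 * (3 * (4 * s)))"
  \<comment> \<open>The scaling by 4 comes from (x + 3 y)^2 + 3 (x - y)^2 = 4 (x^2 + 3 y^2); the two
    new coordinates differ by 4 y, and they are odd because x + y is.\<close>
  have "(form_weight (4 * s) 3 has_sum ?S) {(x, y). odd (x + y)}"
    using assms by (intro has_sum_form_weight_odd_sum) auto
  then have "(form_weight s 3 has_sum ?S) {(x, y). odd x \<and> odd y \<and> 4 dvd x - y}"
  proof (subst (asm) has_sum_reindex_bij_witness[where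
          i = "\<lambda>(x, y). ((x + 3 * y) div 4, (x - y) div 4)" and j = "\<lambda>(x, y). (x + 3 * y, x - y)"
          and T = "{(x, y). odd x \<and> odd y \<and> 4 dvd x - y}" and s' = ?S and h = "form_weight s 3"])
    fix p :: "int \<times> int" assume "p \<in> {(x, y). odd x \<and> odd y \<and> 4 dvd x - y}"
    then obtain x y k where [simp]: "p = (x, y)" and x: "x = y + 4 * k" and "odd y"
      by (auto elim!: dvdE simp: algebra_simps)
    have [simp]: "(y + 4 * k + 3 * y) div 4 = y + k"
      by presburger
    show "(\<lambda>(x, y). (x + 3 * y, x - y)) ((\<lambda>(x, y). ((x + 3 * y) div 4, (x - y) div 4)) p) = p"
      by (simp add: x)
    show "(\<lambda>(x, y). ((x + 3 * y) div 4, (x - y) div 4)) p \<in> {(x, y). odd (x + y)}"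
      using \<open>odd y\<close> by (simp add: x)
  next
    fix p :: "int \<times> int" assume "p \<in> {(x, y). odd (x + y)}"
    then show "(\<lambda>(x, y). (x + 3 * y, x - y)) p \<in> {(x, y). odd x \<and> odd y \<and> 4 dvd x - y}"
      by auto
  qed (auto simp: form_weight_def power2_eq_square algebra_simps)
  with has_sum_form_weight_odd_pairs_cong[of s 3] assms
  have "odd_theta s * odd_theta (3 * s) / 2 = ?S"
    by (auto dest: has_sum_unique)
  then show ?thesis by (simp add: algebra_simps)
qed

text \<open>Both bijections are multiplication by \<open>\<pi> = (1 + sqrt (-7)) / 2\<close>, of norm 2. An element
  \<open>(X + Y * sqrt (-7)) / 2\<close> with odd \<open>X\<close>, \<open>Y\<close> is divisible by exactly one of \<open>\<pi>\<close> and its conjugate,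
  and the quotient either lies in \<open>\<int>[sqrt (-7)]\<close> or again has odd coordinates.\<close>

lemma odd_theta_7:
  assumes "s > 0"
  shows "odd_theta s * odd_theta (7 * s) =
    2 * (theta (32 * s) * odd_theta (56 * s) + odd_theta (8 * s) * theta (224 * s))
    + odd_theta (2 * s) * odd_theta (14 * s)"
proof -
  let ?S = "theta (4 * (8 * s)) * odd_theta (7 * (8 * s)) + odd_theta (8 * s) * theta (4 * (7 * (8 * s)))"
  let ?T = "odd_theta (2 * s) * odd_theta (7 * (2 * s)) / 2"
  \<comment> \<open>Multiplication by 1 + sqrt (-7), of norm 8: (x - 7 y)^2 + 7 (x + y)^2 = 8 (x^2 +
    7 y^2), with new coordinates that differ by a multiple of 8.\<close>
  have "(form_weight (8 * s) 7 has_sum ?S) {(x, y). odd (x + y)}"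
    using assms by (intro has_sum_form_weight_odd_sum) auto
  then have S: "(form_weight s 7 has_sum ?S) {(x, y). odd x \<and> odd y \<and> 8 dvd x - y}"
  proof (subst (asm) has_sum_reindex_bij_witness[where
          i = "\<lambda>(x, y). ((x + 7 * y) div 8, (y - x) div 8)" and j = "\<lambda>(x, y). (x - 7 * y, x + y)"
          and T = "{(x, y). odd x \<and> odd y \<and> 8 dvd x - y}" and s' = ?S and h = "form_weight s 7"])
    fix p :: "int \<times> int" assume "p \<in> {(x, y). odd x \<and> odd y \<and> 8 dvd x - y}"
    then obtain x y k where [simp]: "p = (x, y)" and x: "x = y + 8 * k" and "odd y"
      by (auto elim!: dvdE simp: algebra_simps)
    have [simp]: "(y + 8 * k + 7 * y) div 8 = y + k" "(-(8 * k)) div 8 = - k"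
      by presburger+
    show "(\<lambda>(x, y). (x - 7 * y, x + y)) ((\<lambda>(x, y). ((x + 7 * y) div 8, (y - x) div 8)) p) = p"
      by (simp add: x)
    show "(\<lambda>(x, y). ((x + 7 * y) div 8, (y - x) div 8)) p \<in> {(x, y). odd (x + y)}"
      using \<open>odd y\<close> by (simp add: x)
  next
    fix p :: "int \<times> int" assume "p \<in> {(x, y). odd (x + y)}"
    then show "(\<lambda>(x, y). (x - 7 * y, x + y)) p \<in> {(x, y). odd x \<and> odd y \<and> 8 dvd x - y}"
      by auto
  qed (auto simp: form_weight_def power2_eq_square algebra_simps)
  \<comment> \<open>The same map halved scales the form by 2. The new coordinates differ by -4 y
    with y odd, hence by 4 modulo 8, so the image is the complementary class.\<close>
  have "(form_weight (2 * s) 7 has_sum ?T) {(x, y). odd x \<and> odd y \<and> 4 dvd x - y}"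
    using assms by (intro has_sum_form_weight_odd_pairs_cong) auto
  then have T: "(form_weight s 7 has_sum ?T) {(x, y). odd x \<and> odd y \<and> 8 dvd x - y - 4}"
  proof (subst (asm) has_sum_reindex_bij_witness[where
          i = "\<lambda>(x, y). ((x + 7 * y) div 4, (y - x) div 4)"
          and j = "\<lambda>(x, y). ((x - 7 * y) div 2, (x + y) div 2)"
          and T = "{(x, y). odd x \<and> odd y \<and> 8 dvd x - y - 4}" and s' = ?T and h = "form_weight s 7"])
    fix p :: "int \<times> int" assume "p \<in> {(x, y). odd x \<and> odd y \<and> 8 dvd x - y - 4}"
    then obtain x y k where [simp]: "p = (x, y)" and x: "x = y + 8 * k + 4" and "odd y"
      by (auto elim!: dvdE simp: algebra_simps)
    have d: "(x + 7 * y) div 4 = 2 * y + 2 * k + 1" "(y - x) div 4 = - 2 * k - 1"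
      using x by presburger+
    have "(2 * y + 2 * k + 1 - 7 * (- 2 * k - 1)) div 2 = x"
      "(2 * y + 2 * k + 1 + (- 2 * k - 1)) div 2 = y"
      using x by presburger+
    with d show "(\<lambda>(x, y). ((x - 7 * y) div 2, (x + y) div 2))
        ((\<lambda>(x, y). ((x + 7 * y) div 4, (y - x) div 4)) p) = p"
      by simp
    show "(\<lambda>(x, y). ((x + 7 * y) div 4, (y - x) div 4)) p \<in> {(x, y). odd x \<and> odd y \<and> 4 dvd x - y}"
      using \<open>odd y\<close> d by simp presburger
  next
    fix p :: "int \<times> int" assume "p \<in> {(x, y). odd x \<and> odd y \<and> 4 dvd x - y}"
    then obtain x y k where [simp]: "p = (x, y)" and x: "x = y + 4 * k" and "odd y"
      by (auto elim!: dvdE simp: algebra_simps)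
    have d: "(x - 7 * y) div 2 = 2 * k - 3 * y" "(x + y) div 2 = y + 2 * k"
      using x by presburger+
    show "(\<lambda>(x, y). ((x - 7 * y) div 2, (x + y) div 2)) p \<in> {(x, y). odd x \<and> odd y \<and> 8 dvd x - y - 4}"
      using \<open>odd y\<close> d by simp presburger
    show "(\<lambda>(x, y). ((x + 7 * y) div 4, (y - x) div 4))
        ((\<lambda>(x, y). ((x - 7 * y) div 2, (x + y) div 2)) p) = p"
      using d x by simp
    show "form_weight s 7 ((\<lambda>(x, y). ((x - 7 * y) div 2, (x + y) div 2)) p) = form_weight (2 * s) 7 p"
      using d by (simp add: x form_weight_def power2_eq_square algebra_simps)
  qed (rule refl)
  have both: "(form_weight s 7 has_sum (?S + ?T))
      ({(x, y). odd x \<and> odd y \<and> 8 dvd x - y} \<union> {(x, y). odd x \<and> odd y \<and> 8 dvd x - y - 4})"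
  proof (rule has_sum_Un_disjoint[OF S T])
    have "\<not> (8 dvd x - y \<and> 8 dvd x - y - 4)" for x y :: int
      by presburger
    then show "{(x::int, y::int). odd x \<and> odd y \<and> 8 dvd x - y} \<inter>
        {(x, y). odd x \<and> odd y \<and> 8 dvd x - y - 4} = {}"
      by blast
  qed
  have "4 dvd x - y \<longleftrightarrow> 8 dvd x - y \<or> 8 dvd x - y - 4" for x y :: int
    by presburger
  then have un: "{(x, y). odd x \<and> odd y \<and> 8 dvd x - y} \<union> {(x, y). odd x \<and> odd y \<and> 8 dvd x - y - 4}
      = {(x::int, y). odd x \<and> odd y \<and> 4 dvd x - y}"
    by blast
  have "odd_theta s * odd_theta (7 * s) / 2 = ?S + ?T"
    using both[unfolded un] has_sum_form_weight_odd_pairs_cong[of s 7] assms by (auto dest: has_sum_unique)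
  then show ?thesis by (simp add: algebra_simps)
qed

section \<open>Inversion\<close>

lemma sum_cis_multiples:
  fixes d :: int
  assumes "l > 0"
  shows "(\<Sum>\<nu><l. cis (2 * pi * of_int d * real \<nu> / real l)) = (if int l dvd d then of_nat l else 0)"
proof -
  define w where "w = cis (2 * pi * of_int d / real l)"
  have eq: "cis (2 * pi * of_int d * real \<nu> / real l) = w ^ \<nu>" for \<nu>
    by (simp add: w_def Complex.DeMoivre mult_ac)
  show ?thesis
  proof (cases "int l dvd d")
    case True
    then obtain k where "d = int l * k" by (elim dvdE)
    with assms have "w = cis (2 * pi * of_int k)"
      by (simp add: w_def mult.assoc del: cis_multiple_2pi)
    also have "\<dots> = 1"
      by (rule cis_multiple_2pi) simp
    finally have "w = 1" .
    with True show ?thesis unfolding eq by simp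
  next
    case False
    have "w \<noteq> 1"
    proof
      assume "w = 1"
      then have "cos (2 * pi * of_int d / real l) = 1"
        by (metis w_def cis.sel(1) one_complex.sel(1))
      then obtain k :: int where "2 * pi * of_int d / real l = of_int k * 2 * pi"
        by (auto simp: cos_one_2pi_int)
      with assms have "real_of_int d = real_of_int (k * int l)"
        by (simp add: field_simps)
      then have "d = k * int l" by linarith
      with False show False by simp
    qed
    moreover have "w ^ l = 1"
      using assms by (simp add: w_def Complex.DeMoivre)
    ultimately show ?thesis
      using False unfolding eq by (simp add: geometric_sum)
  qed
qed

text \<open>Expand (e^(i t) + e^(-i t))^(2 m) at t = pi \<nu> / l. Summation over \<nu> annihilates
  every exponent whose offset from the centre is not a multiple of l.\<close>

lemma sum_even_power_cos:
  assumes "l > 0"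
  shows "(\<Sum>\<nu><l. (2 * cos (pi * real \<nu> / real l)) ^ (2 * m)) =
    real l * (\<Sum>i | i \<le> 2 * m \<and> int l dvd int i - int m. real (2 * m choose i))"
proof -
  have expand: "complex_of_real ((2 * cos \<theta>) ^ (2 * m)) =
    (\<Sum>i\<le>2 * m. of_nat (2 * m choose i) * cis (2 * of_int (int i - int m) * \<theta>))" for \<theta>
  proof -
    have "complex_of_real (2 * cos \<theta>) = cis \<theta> + cis (- \<theta>)"
      by (simp add: complex_eq_iff)
    then have "complex_of_real ((2 * cos \<theta>) ^ (2 * m)) = (cis \<theta> + cis (- \<theta>)) ^ (2 * m)"
      by (metis of_real_power)
    also have "\<dots> = (\<Sum>i\<le>2 * m. of_nat (2 * m choose i) * cis \<theta> ^ i * cis (- \<theta>) ^ (2 * m - i))"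
      by (rule binomial_ring)
    also have "\<dots> = (\<Sum>i\<le>2 * m. of_nat (2 * m choose i) * cis (2 * of_int (int i - int m) * \<theta>))"
      by (intro sum.cong refl) (auto simp: Complex.DeMoivre cis_mult mult.assoc of_nat_diff algebra_simps)
    finally show ?thesis .
  qed
  have "complex_of_real (\<Sum>\<nu><l. (2 * cos (pi * real \<nu> / real l)) ^ (2 * m)) =
    (\<Sum>\<nu><l. \<Sum>i\<le>2 * m. of_nat (2 * m choose i) * cis (2 * pi * of_int (int i - int m) * real \<nu> / real l))"
    unfolding of_real_sum expand by (simp add: mult_ac)
  also have "\<dots> = (\<Sum>i\<le>2 * m. of_nat (2 * m choose i) *
      (\<Sum>\<nu><l. cis (2 * pi * of_int (int i - int m) * real \<nu> / real l)))"
    by (subst sum.swap) (simp only: sum_distrib_left)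
  also have "\<dots> = (\<Sum>i\<le>2 * m. if int l dvd int i - int m then of_nat l * of_nat (2 * m choose i) else 0)"
    unfolding sum_cis_multiples[OF assms] by (intro sum.cong) auto
  also have "\<dots> = (\<Sum>i | i \<le> 2 * m \<and> int l dvd int i - int m. of_nat l * of_nat (2 * m choose i))"
    by (subst sum.inter_filter[symmetric]) auto
  also have "\<dots> = complex_of_real (real l *
      (\<Sum>i | i \<le> 2 * m \<and> int l dvd int i - int m. real (2 * m choose i)))"
    by (simp add: sum_distrib_left)
  finally show ?thesis
    by (simp only: of_real_eq_iff)
qed

text \<open>Binomial symmetry folds the sum about the central index. The bound k < m reaches every
  nonzero term because l > 0; beyond the row the coefficients are 0.\<close>

lemma sum_binomial_multiples:
  assumes "l > 0"
  shows "(\<Sum>i | i \<le> 2 * m \<and> int l dvd int i - int m. real (2 * m choose i)) =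
    real (2 * m choose m) + 2 * (\<Sum>k<m. real (2 * m choose (m + Suc k * l)))"
proof -
  let ?f = "\<lambda>i. real (2 * m choose i)"
  let ?T = "{i. m < i \<and> i \<le> 2 * m \<and> int l dvd int i - int m}"
  let ?S = "{i. i < m \<and> int l dvd int i - int m}"
  have dvd: "int l dvd int i - int m \<longleftrightarrow> l dvd i - m" if "m \<le> i" for i
    using that by (simp flip: of_nat_diff)
  have "sum ?f ?T = (\<Sum>k\<in>{k. k < m \<and> m + Suc k * l \<le> 2 * m}. ?f (m + Suc k * l))"
  proof (rule sum.reindex_bij_witness[where i = "\<lambda>k. m + Suc k * l" and j = "\<lambda>i. (i - m) div l - 1"])
    fix i assume i: "i \<in> ?T"
    then have "l dvd i - m" using dvd[of i] by simp
    then obtain c where c: "i - m = l * c" by (elim dvdE)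
    with i have "c > 0" by (cases c) auto
    then obtain c' where [simp]: "c = Suc c'" by (cases c) auto
    have i': "i = m + Suc c' * l" using c i by (simp add: mult.commute) linarith
    have [simp]: "(i - m) div l - 1 = c'" using c assms by simp
    show 1: "m + Suc ((i - m) div l - 1) * l = i" by (simp add: i')
    have "Suc c' * 1 \<le> Suc c' * l" using assms by (intro mult_le_mono2) simp
    moreover have "Suc c' * l \<le> m" using i unfolding i' by simp
    ultimately have "c' < m" by simp
    then show "(i - m) div l - 1 \<in> {k. k < m \<and> m + Suc k * l \<le> 2 * m}"
      using i i' by simp
    show "?f (m + Suc ((i - m) div l - 1) * l) = ?f i" using 1 by simp
  next
    fix k assume "k \<in> {k. k < m \<and> m + Suc k * l \<le> 2 * m}"
    moreover have "int l dvd int (m + Suc k * l) - int m" by simp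
    moreover have "m < m + Suc k * l" using assms by simp
    ultimately show "m + Suc k * l \<in> ?T" by blast
    show "(m + Suc k * l - m) div l - 1 = k" using assms by simp
  qed
  also have "\<dots> = (\<Sum>k<m. ?f (m + Suc k * l))"
    by (rule sum.mono_neutral_left) (auto intro!: binomial_eq_0)
  finally have T: "sum ?f ?T = (\<Sum>k<m. ?f (m + Suc k * l))" .
  have S: "sum ?f ?S = sum ?f ?T"
  proof (rule sum.reindex_bij_witness[where i = "\<lambda>i. 2 * m - i" and j = "\<lambda>i. 2 * m - i"])
    fix i assume i: "i \<in> ?S"
    then have "int (2 * m - i) - int m = - (int i - int m)" by (simp add: of_nat_diff)
    with i have "int l dvd int (2 * m - i) - int m" by (simp only: mem_Collect_eq dvd_minus_iff)
    moreover from i have "m < 2 * m - i" "2 * m - i \<le> 2 * m" by simp_all linarith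
    ultimately show "2 * m - i \<in> ?T" by blast
    show "?f (2 * m - i) = ?f i"
      using i binomial_symmetric[of i "2 * m"] by simp
    show "2 * m - (2 * m - i) = i" using i by simp
  next
    fix i assume i: "i \<in> ?T"
    then have "int (2 * m - i) - int m = - (int i - int m)" by (simp add: of_nat_diff)
    with i have "int l dvd int (2 * m - i) - int m" by (simp only: mem_Collect_eq dvd_minus_iff)
    moreover from i have "2 * m - i < m" by simp linarith
    ultimately show "2 * m - i \<in> ?S" by blast
    show "2 * m - (2 * m - i) = i" using i by simp
  qed
  have "{i. i \<le> 2 * m \<and> int l dvd int i - int m} = insert m (?S \<union> ?T)"
  proof (intro set_eqI)
    fix i
    show "i \<in> {i. i \<le> 2 * m \<and> int l dvd int i - int m} \<longleftrightarrow> i \<in> insert m (?S \<union> ?T)"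
      by (cases i m rule: linorder_cases) simp_all
  qed
  moreover have "finite ?S" "finite ?T"
    by (rule finite_subset[of _ "{..2 * m}"]; force)+
  moreover have "?S \<inter> ?T = {}" "m \<notin> ?S \<union> ?T"
    by force+
  ultimately have "(\<Sum>i | i \<le> 2 * m \<and> int l dvd int i - int m. ?f i) = ?f m + (sum ?f ?S + sum ?f ?T)"
    by (simp only: sum.insert sum.union_disjoint finite_Un if_False simp_thms)
  then show ?thesis
    unfolding S T by simp
qed

text \<open>The reflection of \<nu> to 2 p - \<nu> changes only the sign of the cosine, which the
  even exponent removes.\<close>

lemma sum_even_power_cos_half:
  assumes "p > 0" "m > 0"
  shows "(\<Sum>\<nu><2 * p. (cos (pi * real \<nu> / real (2 * p))) ^ (2 * m)) =
    1 + 2 * (\<Sum>k<p. (cos (pi * real (Suc k) / real (2 * p))) ^ (2 * m))"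
proof -
  let ?g = "\<lambda>\<nu>. (cos (pi * real \<nu> / real (2 * p))) ^ (2 * m)"
  obtain r where r: "p = Suc r" using assms by (cases p) auto
  have refl: "?g (2 * p - \<nu>) = ?g \<nu>" if "\<nu> \<le> 2 * p" for \<nu>
  proof -
    have "pi * real (2 * p - \<nu>) / real (2 * p) = pi - pi * real \<nu> / real (2 * p)"
      using assms that by (simp add: of_nat_diff field_simps)
    then show ?thesis by simp
  qed
  \<comment> \<open>The middle term vanishes as m > 0, so it may be counted in both halves and each
    half runs over 1..p.\<close>
  have "cos (pi * real p / real (2 * p)) = 0"
    using assms by simp
  then have gp: "?g p = 0" using assms by simp
  have "{..<2 * p} = insert 0 ({1..p} \<union> {p<..<2 * p})" using assms by auto
  then have "sum ?g {..<2 * p} = sum ?g (insert 0 ({1..p} \<union> {p<..<2 * p}))"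
    by (simp only:)
  also have "\<dots> = ?g 0 + (sum ?g {1..p} + sum ?g {p<..<2 * p})"
    by (subst sum.insert, simp, simp, subst sum.union_disjoint) auto
  also have "sum ?g {p<..<2 * p} = sum ?g {1..r}"
  proof (rule sum.reindex_bij_witness[where i = "\<lambda>\<nu>. 2 * p - \<nu>" and j = "\<lambda>\<nu>. 2 * p - \<nu>"])
    fix \<nu> assume "\<nu> \<in> {p<..<2 * p}"
    then show "?g (2 * p - \<nu>) = ?g \<nu>" by (intro refl) simp
  qed (auto simp: r)
  also have "\<dots> = sum ?g {1..p}"
    using gp by (simp add: r)
  also have "sum ?g {1..p} = (\<Sum>k<p. ?g (Suc k))"
    unfolding One_nat_def by (rule sum.atLeast1_atMost_eq)
  finally show ?thesis by simp
qed

section \<open>Gaussian behaviour of binomial coefficients\<close>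

definition binomial_ratio :: "nat \<Rightarrow> nat \<Rightarrow> real" where
  "binomial_ratio m r = real (2 * m choose (m + r)) / real (2 * m choose m)"

lemma binomial_theta_identity:
  assumes "p > 0" "m > 0"
  shows "2 ^ (2 * m) * (1 + 2 * (\<Sum>k<p. (cos (pi * real (Suc k) / real (2 * p))) ^ (2 * m))) =
    real (2 * p) * real (2 * m choose m) * (1 + 2 * (\<Sum>k<m. binomial_ratio m (Suc k * (2 * p))))"
proof -
  have "2 ^ (2 * m) * (1 + 2 * (\<Sum>k<p. (cos (pi * real (Suc k) / real (2 * p))) ^ (2 * m)))
      = (\<Sum>\<nu><2 * p. (2 * cos (pi * real \<nu> / real (2 * p))) ^ (2 * m))"
    by (simp only: sum_even_power_cos_half[OF assms, symmetric] power_mult_distrib sum_distrib_left[of "2 ^ (2 * m)"])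
  also have "\<dots> = real (2 * p) * (real (2 * m choose m) +
      2 * (\<Sum>k<m. real (2 * m choose (m + Suc k * (2 * p)))))"
    using assms by (subst sum_even_power_cos) (simp_all only: sum_binomial_multiples)
  also have "(\<Sum>k<m. real (2 * m choose (m + Suc k * (2 * p)))) =
      real (2 * m choose m) * (\<Sum>k<m. binomial_ratio m (Suc k * (2 * p)))"
    by (simp add: binomial_ratio_def flip: sum_divide_distrib)
  finally show ?thesis by (simp add: algebra_simps)
qed

lemma binomial_ratio_0 [simp]: "binomial_ratio m 0 = 1"
  by (simp add: binomial_ratio_def)

lemma binomial_ratio_nonneg: "binomial_ratio m r \<ge> 0"
  by (simp add: binomial_ratio_def)

lemma binomial_ratio_eq_0: "r > m \<Longrightarrow> binomial_ratio m r = 0"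
  by (simp add: binomial_ratio_def binomial_eq_0)

lemma binomial_ratio_Suc:
  assumes "r < m"
  shows "binomial_ratio m (Suc r) = binomial_ratio m r * ((real m - real r) / (real m + real r + 1))"
proof -
  have "Suc (m + r) * (2 * m choose Suc (m + r)) = (2 * m - (m + r)) * (2 * m choose (m + r))"
    by (metis binomial_absorb_comp binomial_absorption mult.commute)
  then have "real (Suc (m + r)) * real (2 * m choose Suc (m + r)) =
      real (2 * m - (m + r)) * real (2 * m choose (m + r))"
    by (metis of_nat_mult)
  then have "real (2 * m choose Suc (m + r)) =
      real (2 * m choose (m + r)) * ((real m - real r) / (real m + real r + 1))"
    using assms by (simp add: of_nat_diff field_simps)
  then show ?thesis
    by (simp add: binomial_ratio_def)
qed

text \<open>The ratio is a product of factors 1 - (2 j + 1) / (m + j + 1), each at most exp (- (2 j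
  + 1) / (m + R)). The odd numbers 2 j + 1 for j < r add up to r^2.\<close>

lemma binomial_ratio_le:
  assumes "r \<le> R" "R \<le> m" "m > 0"
  shows "binomial_ratio m r \<le> exp (- ((real r)\<^sup>2 / (real m + real R)))"
  using assms(1)
proof (induction r)
  case (Suc r)
  then have r: "r < m" "r < R" using assms by auto
  have "(real m - real r) / (real m + real r + 1) = 1 + - ((2 * real r + 1) / (real m + real r + 1))"
    by (simp add: field_simps)
  also have "\<dots> \<le> exp (- ((2 * real r + 1) / (real m + real r + 1)))"
    by (rule exp_ge_add_one_self)
  also have "\<dots> \<le> exp (- ((2 * real r + 1) / (real m + real R)))"
    using r by (auto intro!: divide_left_mono)
  finally have "binomial_ratio m (Suc r) \<le>
      exp (- ((real r)\<^sup>2 / (real m + real R))) * exp (- ((2 * real r + 1) / (real m + real R)))"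
    unfolding binomial_ratio_Suc[OF r(1)] using Suc r by (intro mult_mono) auto
  also have "\<dots> = exp (- ((real (Suc r))\<^sup>2 / (real m + real R)))"
    by (simp add: power2_eq_square add_divide_distrib algebra_simps flip: exp_add)
  finally show ?case .
qed simp

text \<open>Here the factors are written as 1 / (1 + (2 j + 1) / (m - j)) and bounded below by 1 /
  (1 + y) \<ge> exp (- y), with m - j \<ge> m - R + 1 for j < R.\<close>

lemma binomial_ratio_ge:
  assumes "r \<le> R" "R \<le> m" "m > 0"
  shows "binomial_ratio m r \<ge> exp (- ((real r)\<^sup>2 / (real m - real R + 1)))"
  using assms(1)
proof (induction r)
  case (Suc r)
  then have r: "r < m" "r < R" using assms by auto
  have "(2 * real r + 1) / (real m - real r) \<le> (2 * real r + 1) / (real m - real R + 1)"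
    using r assms by (intro divide_left_mono mult_pos_pos) auto
  then have "exp (- ((2 * real r + 1) / (real m - real R + 1))) \<le> exp (- ((2 * real r + 1) / (real m - real r)))"
    by simp
  also have "\<dots> = 1 / exp ((2 * real r + 1) / (real m - real r))"
    by (simp add: exp_minus field_simps)
  also have "\<dots> \<le> 1 / (1 + (2 * real r + 1) / (real m - real r))"
    using r by (intro divide_left_mono exp_ge_add_one_self mult_pos_pos add_pos_nonneg divide_nonneg_pos) auto
  also have "\<dots> = (real m - real r) / (real m + real r + 1)"
    using r by (simp add: field_simps)
  finally have "exp (- ((real r)\<^sup>2 / (real m - real R + 1))) * exp (- ((2 * real r + 1) / (real m - real R + 1)))
     \<le> binomial_ratio m (Suc r)"
    unfolding binomial_ratio_Suc[OF r(1)] using Suc r by (intro mult_mono binomial_ratio_nonneg) auto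
  then show ?case
    by (simp add: power2_eq_square add_divide_distrib algebra_simps flip: exp_add)
qed simp

text \<open>Convergence of r^2 / m together with m tending to infinity forces r / m to 0. Both
  bounds with R = r then have an exponent tending to - L.\<close>

lemma tendsto_binomial_ratio:
  fixes m r :: "nat \<Rightarrow> nat"
  assumes m: "filterlim m at_top sequentially" and L: "(\<lambda>n. (real (r n))\<^sup>2 / real (m n)) \<longlonglongrightarrow> L"
  shows "(\<lambda>n. binomial_ratio (m n) (r n)) \<longlonglongrightarrow> exp (- L)"
proof -
  have m': "filterlim (\<lambda>n. real (m n)) at_top sequentially"
    by (rule filterlim_compose[OF filterlim_real_sequentially m])
  have inv: "(\<lambda>n. 1 / real (m n)) \<longlonglongrightarrow> 0"
    by (intro real_tendsto_divide_at_top[OF tendsto_const] m')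
  have "(\<lambda>n. sqrt ((real (r n))\<^sup>2 / real (m n) * (1 / real (m n)))) \<longlonglongrightarrow> sqrt (L * 0)"
    by (intro tendsto_intros L inv)
  then have rm: "(\<lambda>n. real (r n) / real (m n)) \<longlonglongrightarrow> 0"
    by (simp add: real_sqrt_divide real_sqrt_mult)
  have "eventually (\<lambda>n. real (r n) / real (m n) < 1) sequentially"
    using rm by (rule order_tendstoD) simp
  moreover have pos: "eventually (\<lambda>n. m n > 0) sequentially"
    by (rule eventually_compose_filterlim[OF eventually_gt_at_top m])
  ultimately have le: "eventually (\<lambda>n. r n \<le> m n \<and> m n > 0) sequentially"
    by eventually_elim auto
  show ?thesis
  proof (rule tendsto_sandwich)
    show "\<forall>\<^sub>F n in sequentially. exp (- ((real (r n))\<^sup>2 / (real (m n) - real (r n) + 1)))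
        \<le> binomial_ratio (m n) (r n)"
      using le by eventually_elim (auto intro: binomial_ratio_ge)
    show "\<forall>\<^sub>F n in sequentially. binomial_ratio (m n) (r n)
        \<le> exp (- ((real (r n))\<^sup>2 / (real (m n) + real (r n))))"
      using le by eventually_elim (auto intro: binomial_ratio_le)
    have "(\<lambda>n. ((real (r n))\<^sup>2 / real (m n)) / (1 - real (r n) / real (m n) + 1 / real (m n)))
        \<longlonglongrightarrow> L / (1 - 0 + 0)"
      by (intro tendsto_intros L rm inv) simp
    moreover have "\<forall>\<^sub>F n in sequentially.
        ((real (r n))\<^sup>2 / real (m n)) / (1 - real (r n) / real (m n) + 1 / real (m n))
        = (real (r n))\<^sup>2 / (real (m n) - real (r n) + 1)"
      using pos
    proof eventually_elim
      case (elim n)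
      then have "1 - real (r n) / real (m n) + 1 / real (m n) = (real (m n) - real (r n) + 1) / real (m n)"
        by (simp add: field_simps)
      with elim show ?case by simp
    qed
    ultimately have "(\<lambda>n. (real (r n))\<^sup>2 / (real (m n) - real (r n) + 1)) \<longlonglongrightarrow> L / (1 - 0 + 0)"
      by (rule Lim_transform_eventually)
    then show "(\<lambda>n. exp (- ((real (r n))\<^sup>2 / (real (m n) - real (r n) + 1)))) \<longlonglongrightarrow> exp (- L)"
      by (intro tendsto_exp tendsto_minus) simp
    have "(\<lambda>n. ((real (r n))\<^sup>2 / real (m n)) / (1 + real (r n) / real (m n))) \<longlonglongrightarrow> L / (1 + 0)"
      by (intro tendsto_intros L rm inv) simp
    moreover have "\<forall>\<^sub>F n in sequentially.
        ((real (r n))\<^sup>2 / real (m n)) / (1 + real (r n) / real (m n))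
        = (real (r n))\<^sup>2 / (real (m n) + real (r n))"
      using pos
    proof eventually_elim
      case (elim n)
      then have "1 + real (r n) / real (m n) = (real (m n) + real (r n)) / real (m n)"
        by (simp add: field_simps)
      with elim show ?case by simp
    qed
    ultimately have "(\<lambda>n. (real (r n))\<^sup>2 / (real (m n) + real (r n))) \<longlonglongrightarrow> L / (1 + 0)"
      by (rule Lim_transform_eventually)
    then show "(\<lambda>n. exp (- ((real (r n))\<^sup>2 / (real (m n) + real (r n))))) \<longlonglongrightarrow> exp (- L)"
      by (intro tendsto_exp tendsto_minus) simp
  qed
qed

section \<open>Gaussian bounds for powers of the cosine\<close>

lemma cos_le_exp:
  assumes "0 \<le> x" "x \<le> pi / 2"
  shows "cos x \<le> exp (- (x\<^sup>2 / 2))"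
proof -
  have sin_ge: "y * cos y \<le> sin y" if "0 \<le> y" "y \<le> pi / 2" for y
  proof -
    have "sin 0 - 0 * cos 0 \<le> sin y - y * cos y"
    proof (rule DERIV_nonneg_imp_nondecreasing[OF that(1)])
      fix z assume z: "0 \<le> z" "z \<le> y"
      have "((\<lambda>z. sin z - z * cos z) has_real_derivative z * sin z) (at z)"
        by (auto intro!: derivative_eq_intros)
      moreover have "0 \<le> z * sin z"
        using z that by (intro mult_nonneg_nonneg sin_ge_zero) auto
      ultimately show "\<exists>d. ((\<lambda>z. sin z - z * cos z) has_real_derivative d) (at z) \<and> 0 \<le> d"
        by blast
    qed
    then show ?thesis by simp
  qed
  have "cos x * exp (x\<^sup>2 / 2) \<le> cos 0 * exp (0\<^sup>2 / 2)"
  proof (rule DERIV_nonpos_imp_nonincreasing[OF assms(1)])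
    fix y assume y: "0 \<le> y" "y \<le> x"
    have "((\<lambda>y. cos y * exp (y\<^sup>2 / 2)) has_real_derivative (y * cos y - sin y) * exp (y\<^sup>2 / 2)) (at y)"
      by (auto intro!: derivative_eq_intros simp: algebra_simps)
    moreover have "(y * cos y - sin y) * exp (y\<^sup>2 / 2) \<le> 0"
      using sin_ge[of y] y assms by (intro mult_nonpos_nonneg) auto
    ultimately show "\<exists>d. ((\<lambda>y. cos y * exp (y\<^sup>2 / 2)) has_real_derivative d) (at y) \<and> d \<le> 0"
      by blast
  qed
  then show ?thesis
    by (simp add: exp_minus field_simps)
qed

lemma cos_power_le_exp:
  assumes "0 \<le> x" "x \<le> pi / 2"
  shows "cos x ^ (2 * m) \<le> exp (- (x\<^sup>2 * real m))"
proof -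
  have "cos x ^ (2 * m) \<le> exp (- (x\<^sup>2 / 2)) ^ (2 * m)"
    using assms by (intro power_mono cos_le_exp cos_ge_zero) auto
  also have "\<dots> = exp (- (x\<^sup>2 * real m))"
    by (simp flip: exp_of_nat_mult add: field_simps)
  finally show ?thesis .
qed

text \<open>With y = x^2 / 2 one has cos x \<ge> 1 - y \<ge> exp (- y / (1 - y)); the second
  inequality is 1 + t \<le> exp t at t = y / (1 - y), inverted.\<close>

lemma cos_power_ge_exp:
  assumes "x\<^sup>2 < 2"
  shows "cos x ^ (2 * m) \<ge> exp (- (x\<^sup>2 * real m / (1 - x\<^sup>2 / 2)))"
proof -
  define y where "y = x\<^sup>2 / 2"
  have y: "0 \<le> y" "y < 1" using assms by (auto simp: y_def)
  have "1 - y \<le> cos x"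
  proof -
    have "(sin (x / 2))\<^sup>2 \<le> (x / 2)\<^sup>2"
      unfolding abs_le_square_iff[symmetric] by (rule abs_sin_x_le_abs_x)
    moreover have "cos x = 1 - 2 * (sin (x / 2))\<^sup>2"
      using cos_double_sin[of "x / 2"] by simp
    ultimately show ?thesis
      by (simp add: y_def power_divide)
  qed
  moreover have "exp (- (y / (1 - y))) \<le> 1 - y"
  proof -
    have "1 / (1 - y) = 1 + y / (1 - y)" using y by (simp add: field_simps)
    also have "\<dots> \<le> exp (y / (1 - y))" by (rule exp_ge_add_one_self)
    finally show ?thesis using y by (simp add: exp_minus field_simps)
  qed
  ultimately have "exp (- (y / (1 - y))) ^ (2 * m) \<le> cos x ^ (2 * m)"
    by (intro power_mono) auto
  also have "exp (- (y / (1 - y))) ^ (2 * m) = exp (- (x\<^sup>2 * real m / (1 - x\<^sup>2 / 2)))"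
  proof -
    have x2: "x\<^sup>2 = 2 * y" by (simp add: y_def)
    have "real (2 * m) * - (y / (1 - y)) = - (x\<^sup>2 * real m / (1 - x\<^sup>2 / 2))"
      unfolding x2 by simp
    then show ?thesis by (simp only: exp_of_nat_mult[symmetric])
  qed
  finally show ?thesis .
qed

lemma tendsto_cos_power:
  fixes m :: "nat \<Rightarrow> nat" and x :: "nat \<Rightarrow> real"
  assumes x: "\<And>n. 0 \<le> x n" "x \<longlonglongrightarrow> 0" and L: "(\<lambda>n. (x n)\<^sup>2 * real (m n)) \<longlonglongrightarrow> L"
  shows "(\<lambda>n. cos (x n) ^ (2 * m n)) \<longlonglongrightarrow> exp (- L)"
proof (rule tendsto_sandwich)
  have "eventually (\<lambda>n. x n < 1) sequentially"
    using x(2) by (rule order_tendstoD) simp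
  then show "\<forall>\<^sub>F n in sequentially. exp (- ((x n)\<^sup>2 * real (m n) / (1 - (x n)\<^sup>2 / 2))) \<le> cos (x n) ^ (2 * m n)"
  proof eventually_elim
    case (elim n)
    then have "(x n)\<^sup>2 < 1" using x(1)[of n] by (simp add: power_less_one_iff abs_square_less_1)
    then show ?case by (intro cos_power_ge_exp) simp
  qed
  have "eventually (\<lambda>n. x n < pi / 2) sequentially"
    using x(2) by (rule order_tendstoD) simp
  then show "\<forall>\<^sub>F n in sequentially. cos (x n) ^ (2 * m n) \<le> exp (- ((x n)\<^sup>2 * real (m n)))"
    by eventually_elim (auto intro!: cos_power_le_exp x)
  show "(\<lambda>n. exp (- ((x n)\<^sup>2 * real (m n)))) \<longlonglongrightarrow> exp (- L)"
    by (intro tendsto_intros L)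
  have "(\<lambda>n. 1 - (x n)\<^sup>2 / 2) \<longlonglongrightarrow> 1 - 0\<^sup>2 / 2"
    by (intro tendsto_intros x) simp
  then have "(\<lambda>n. exp (- ((x n)\<^sup>2 * real (m n) / (1 - (x n)\<^sup>2 / 2)))) \<longlonglongrightarrow> exp (- (L / 1))"
    by (intro tendsto_exp tendsto_minus tendsto_divide L) auto
  then show "(\<lambda>n. exp (- ((x n)\<^sup>2 * real (m n) / (1 - (x n)\<^sup>2 / 2)))) \<longlonglongrightarrow> exp (- L)"
    by simp
qed

section \<open>Limits of the two finite sums by Tannery's theorem\<close>

lemma tendsto_binomial_theta:
  fixes m p :: "nat \<Rightarrow> nat"
  assumes s: "s > 0" and m: "filterlim m at_top sequentially"
    and L: "(\<lambda>n. (real (2 * p n))\<^sup>2 / real (m n)) \<longlonglongrightarrow> pi * s" and p: "\<And>n. p n > 0"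
  shows "(\<lambda>n. 1 + 2 * (\<Sum>k<m n. binomial_ratio (m n) (Suc k * (2 * p n)))) \<longlonglongrightarrow> theta s"
proof -
  let ?a = "\<lambda>k n. binomial_ratio (m n) (Suc k * (2 * p n))"
  \<comment> \<open>The dominating series loses two factors of 2: one because (2 p)^2 / m eventually
    exceeds only half its limit, one because the bound for the ratio is used with R = m.\<close>
  let ?M = "\<lambda>k. exp (- (pi * (s / 4) * (real (Suc k))\<^sup>2))"
  have "(\<lambda>n. suminf (\<lambda>k. ?a k n)) \<longlonglongrightarrow> (\<Sum>k. exp (- (pi * s * (real (Suc k))\<^sup>2)))"
  proof (rule tannerys_theorem[THEN conjunct2, THEN conjunct2])
    fix k
    have "(\<lambda>n. (real (Suc k))\<^sup>2 * ((real (2 * p n))\<^sup>2 / real (m n))) \<longlonglongrightarrow> (real (Suc k))\<^sup>2 * (pi * s)"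
      by (intro tendsto_intros L)
    then have "(\<lambda>n. (real (Suc k * (2 * p n)))\<^sup>2 / real (m n)) \<longlonglongrightarrow> pi * s * (real (Suc k))\<^sup>2"
      by (simp only: of_nat_mult power_mult_distrib times_divide_eq_right mult_ac)
    then show "(\<lambda>n. ?a k n) \<longlonglongrightarrow> exp (- (pi * s * (real (Suc k))\<^sup>2))"
      by (rule tendsto_binomial_ratio[OF m])
  next
    have "eventually (\<lambda>n. pi * s / 2 < (real (2 * p n))\<^sup>2 / real (m n)) sequentially"
      using L by (rule order_tendstoD) (use s in simp)
    then have "eventually (\<lambda>n. \<forall>k. norm (?a k n) \<le> ?M k) sequentially"
    proof eventually_elim
      case (elim n)
      show ?case
      proof
        fix k
        let ?r = "Suc k * (2 * p n)"
        show "norm (?a k n) \<le> ?M k"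
        proof (cases "?r \<le> m n")
          case True
          then have m0: "m n > 0" using p[of n] by (cases "m n") auto
          have "pi * (s / 4) * (real (Suc k))\<^sup>2 = (real (Suc k))\<^sup>2 * (pi * s / 2) / 2"
            by simp
          also have "\<dots> \<le> (real (Suc k))\<^sup>2 * ((real (2 * p n))\<^sup>2 / real (m n)) / 2"
            using elim by (intro divide_right_mono mult_left_mono) auto
          also have "\<dots> = (real ?r)\<^sup>2 / (real (m n) + real (m n))"
            by (simp only: of_nat_mult power_mult_distrib) simp
          finally have "exp (- ((real ?r)\<^sup>2 / (real (m n) + real (m n)))) \<le> ?M k"
            by (simp only: exp_le_cancel_iff neg_le_iff_le)
          with binomial_ratio_le[OF True order_refl m0] have "?a k n \<le> ?M k"
            by (rule order_trans)
          then show ?thesis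
            using binomial_ratio_nonneg[of "m n" ?r] by (simp only: real_norm_def abs_of_nonneg)
        next
          case False
          then have "?a k n = 0" by (intro binomial_ratio_eq_0) simp
          then show ?thesis by (simp del: mult_Suc)
        qed
      qed
    qed
    then show "\<forall>\<^sub>F (k, n) in at_top \<times>\<^sub>F sequentially. norm (?a k n) \<le> ?M k"
      unfolding eventually_prod_filter
      by (intro exI[of _ "\<lambda>_. True"] exI[of _ "\<lambda>n. \<forall>k. norm (?a k n) \<le> ?M k"]) auto
    show "summable ?M" using s by (intro summable_gauss) simp
  qed simp
  moreover have "suminf (\<lambda>k. ?a k n) = (\<Sum>k<m n. ?a k n)" for n
  proof (rule suminf_finite)
    fix k assume "k \<notin> {..<m n}"
    then have "m n < Suc k * 1" by simp
    also have "\<dots> \<le> Suc k * (2 * p n)"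
      using p[of n] by (intro mult_le_mono) auto
    finally show "?a k n = 0" by (rule binomial_ratio_eq_0)
  qed simp
  ultimately have "(\<lambda>n. 1 + 2 * (\<Sum>k<m n. ?a k n)) \<longlonglongrightarrow>
      1 + 2 * (\<Sum>k. exp (- (pi * s * (real (Suc k))\<^sup>2)))"
    by (intro tendsto_intros) simp
  then show ?thesis unfolding theta_suminf[OF s] .
qed

lemma tendsto_cos_theta:
  fixes m p :: "nat \<Rightarrow> nat"
  assumes s: "s > 0" and p: "filterlim p at_top sequentially"
    and L: "(\<lambda>n. (real (2 * p n))\<^sup>2 / real (m n)) \<longlonglongrightarrow> pi * s" and p0: "\<And>n. p n > 0"
  shows "(\<lambda>n. 1 + 2 * (\<Sum>k<p n. (cos (pi * real (Suc k) / real (2 * p n))) ^ (2 * m n))) \<longlonglongrightarrow> theta (1 / s)"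
proof -
  let ?x = "\<lambda>k n. pi * real (Suc k) / real (2 * p n)"
  \<comment> \<open>Extending the finite sum by 0 gives a series over all k. In the majorant only
    one factor of 2 is lost, from the eventual lower bound by half the limit.\<close>
  let ?a = "\<lambda>k n. if k < p n then cos (?x k n) ^ (2 * m n) else 0"
  let ?M = "\<lambda>k. exp (- (pi * (1 / (2 * s)) * (real (Suc k))\<^sup>2))"
  have L': "(\<lambda>n. real (m n) / (real (2 * p n))\<^sup>2) \<longlonglongrightarrow> 1 / (pi * s)"
    using tendsto_inverse[OF L] s by (simp add: inverse_eq_divide)
  have x2: "(?x k n)\<^sup>2 * real (m n) = pi\<^sup>2 * (real (Suc k))\<^sup>2 * (real (m n) / (real (2 * p n))\<^sup>2)" for k n
    by (simp only: power_divide power_mult_distrib) simp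
  have p2: "filterlim (\<lambda>n. real (2 * p n)) at_top sequentially"
    using filterlim_compose[OF filterlim_real_sequentially p]
    by (simp add: filterlim_tendsto_pos_mult_at_top[OF tendsto_const])
  have "(\<lambda>n. suminf (\<lambda>k. ?a k n)) \<longlonglongrightarrow> (\<Sum>k. exp (- (pi * (1 / s) * (real (Suc k))\<^sup>2)))"
  proof (rule tannerys_theorem[THEN conjunct2, THEN conjunct2])
    fix k
    have "(\<lambda>n. (?x k n)\<^sup>2 * real (m n)) \<longlonglongrightarrow> pi\<^sup>2 * (real (Suc k))\<^sup>2 * (1 / (pi * s))"
      unfolding x2 by (intro tendsto_intros L')
    then have "(\<lambda>n. (?x k n)\<^sup>2 * real (m n)) \<longlonglongrightarrow> pi * (1 / s) * (real (Suc k))\<^sup>2"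
      by (simp add: power2_eq_square mult_ac)
    moreover have "(\<lambda>n. ?x k n) \<longlonglongrightarrow> 0"
      by (intro real_tendsto_divide_at_top[OF tendsto_const] p2)
    ultimately have "(\<lambda>n. cos (?x k n) ^ (2 * m n)) \<longlonglongrightarrow> exp (- (pi * (1 / s) * (real (Suc k))\<^sup>2))"
      by (intro tendsto_cos_power) auto
    moreover have "eventually (\<lambda>n. k < p n) sequentially"
      by (rule eventually_compose_filterlim[OF eventually_gt_at_top p])
    then have "eventually (\<lambda>n. cos (?x k n) ^ (2 * m n) = ?a k n) sequentially"
      by eventually_elim simp
    ultimately show "(\<lambda>n. ?a k n) \<longlonglongrightarrow> exp (- (pi * (1 / s) * (real (Suc k))\<^sup>2))"
      by (rule Lim_transform_eventually)
  next
    have "1 / (pi * s) / 2 < 1 / (pi * s)"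
      using s by (simp add: field_simps)
    with L' have "eventually (\<lambda>n. 1 / (pi * s) / 2 < real (m n) / (real (2 * p n))\<^sup>2) sequentially"
      by (rule order_tendstoD)
    then have "eventually (\<lambda>n. \<forall>k. norm (?a k n) \<le> ?M k) sequentially"
    proof eventually_elim
      case (elim n)
      show ?case
      proof
        fix k
        show "norm (?a k n) \<le> ?M k"
        proof (cases "k < p n")
          case True
          have "pi * (1 / (2 * s)) * (real (Suc k))\<^sup>2 = pi\<^sup>2 * (real (Suc k))\<^sup>2 * (1 / (pi * s) / 2)"
            by (simp add: power2_eq_square)
          also have "\<dots> \<le> (?x k n)\<^sup>2 * real (m n)"
            unfolding x2 using elim by (intro mult_left_mono) auto
          finally have "exp (- ((?x k n)\<^sup>2 * real (m n))) \<le> ?M k"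
            by (simp only: exp_le_cancel_iff neg_le_iff_le)
          moreover have "?x k n \<le> pi / 2"
          proof -
            have "pi * real (Suc k) \<le> pi * real (p n)"
              using True by (intro mult_left_mono) auto
            then show ?thesis
              using p0[of n] by (simp add: divide_le_eq)
          qed
          ultimately have "cos (?x k n) ^ (2 * m n) \<le> ?M k"
            by (intro order_trans[OF cos_power_le_exp]) auto
          with True show ?thesis by simp
        qed simp
      qed
    qed
    then show "\<forall>\<^sub>F (k, n) in at_top \<times>\<^sub>F sequentially. norm (?a k n) \<le> ?M k"
      unfolding eventually_prod_filter
      by (intro exI[of _ "\<lambda>_. True"] exI[of _ "\<lambda>n. \<forall>k. norm (?a k n) \<le> ?M k"]) auto
    show "summable ?M" using s by (intro summable_gauss) simp
  qed simp
  moreover have "suminf (\<lambda>k. ?a k n) = (\<Sum>k<p n. (cos (?x k n)) ^ (2 * m n))" for n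
  proof -
    have "suminf (\<lambda>k. ?a k n) = (\<Sum>k<p n. ?a k n)"
      by (rule suminf_finite) auto
    then show ?thesis by simp
  qed
  ultimately have "(\<lambda>n. 1 + 2 * (\<Sum>k<p n. (cos (?x k n)) ^ (2 * m n))) \<longlonglongrightarrow>
      1 + 2 * (\<Sum>k. exp (- (pi * (1 / s) * (real (Suc k))\<^sup>2)))"
    by (intro tendsto_intros) simp
  then show ?thesis using s by (subst theta_suminf) auto
qed

text \<open>Replacing \<open>p\<close> by \<open>2 * p\<close> for the same \<open>m\<close> replaces \<open>s\<close> by \<open>4 * s\<close> in the limit, and the central
  binomial coefficient cancels, so its asymptotics are not required.\<close>

lemma theta_inversion:
  assumes "s > 0"
  shows "2 * theta (4 * s) * theta (1 / s) = theta s * theta (1 / (4 * s))"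
proof -
  \<comment> \<open>Chosen so that (2 p)^2 / m tends to pi * s for p = n + 1. The parameter c then
    multiplies p, and so multiplies the limit by c^2.\<close>
  define m where "m n = nat \<lfloor>4 * (real (Suc n))\<^sup>2 / (pi * s)\<rfloor>" for n
  define B where "B c n = 1 + 2 * (\<Sum>k<m n. binomial_ratio (m n) (Suc k * (2 * (c * Suc n))))" for c n
  define C where "C c n = 1 + 2 * (\<Sum>k<c * Suc n. (cos (pi * real (Suc k) / real (2 * (c * Suc n)))) ^ (2 * m n))" for c n
  have m_at_top: "filterlim m at_top sequentially"
    unfolding m_def using assms by real_asymp
  have m_lim: "(\<lambda>n. (real (Suc n))\<^sup>2 / real (m n)) \<longlonglongrightarrow> pi * s / 4"
    unfolding m_def using assms by real_asymp
  have lim: "(\<lambda>n. (real (2 * (c * Suc n)))\<^sup>2 / real (m n)) \<longlonglongrightarrow> pi * (real c ^ 2 * s)" for c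
  proof -
    have "(\<lambda>n. (2 * real c)\<^sup>2 * ((real (Suc n))\<^sup>2 / real (m n))) \<longlonglongrightarrow> (2 * real c)\<^sup>2 * (pi * s / 4)"
      by (intro tendsto_intros m_lim)
    then show ?thesis
      by (simp only: of_nat_mult power_mult_distrib) (simp add: mult_ac)
  qed
  have B: "B c \<longlonglongrightarrow> theta (real c ^ 2 * s)" if "c > 0" for c
    unfolding B_def using assms that lim m_at_top by (intro tendsto_binomial_theta) auto
  have C: "C c \<longlonglongrightarrow> theta (1 / (real c ^ 2 * s))" if "c > 0" for c
  proof -
    have "filterlim (\<lambda>n. c * Suc n) at_top sequentially"
      using that by (intro filterlim_at_top_mono[OF filterlim_Suc] always_eventually allI)
        (cases c, auto)
    then show ?thesis
      unfolding C_def using assms that lim by (intro tendsto_cos_theta) auto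
  qed
  have "eventually (\<lambda>n. m n > 0) sequentially"
    by (rule eventually_compose_filterlim[OF eventually_gt_at_top m_at_top])
  then have ev: "eventually (\<lambda>n. B 1 n * C 2 n = 2 * B 2 n * C 1 n) sequentially" 
  proof eventually_elim
    case (elim n)
    have *: "2 ^ (2 * m n) * C c n = real (2 * (c * Suc n)) * real (2 * m n choose m n) * B c n" if "c > 0" for c
      unfolding B_def C_def using that elim by (intro binomial_theta_identity) auto
    \<comment> \<open>The common nonzero factor of the cross product of the identities for c = 1 and
      c = 2; the surviving 2 is the quotient of the two values of p.\<close>
    let ?K = "2 ^ (2 * m n) * (real (2 * Suc n) * real (2 * m n choose m n))"
    have "?K * (B 1 n * C 2 n) = (2 ^ (2 * m n) * C 2 n) * (real (2 * Suc n) * real (2 * m n choose m n) * B 1 n)"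
      by (simp only: mult_ac)
    also have "\<dots> = (real (2 * (2 * Suc n)) * real (2 * m n choose m n) * B 2 n) * (2 ^ (2 * m n) * C 1 n)"
      using *[of 1] *[of 2] by simp
    also have "\<dots> = ?K * (2 * B 2 n * C 1 n)"
      by simp
    finally show ?case by (simp del: of_nat_Suc)
  qed
  have "(\<lambda>n. B 1 n * C 2 n) \<longlonglongrightarrow> theta s * theta (1 / (4 * s))"
    using tendsto_mult[OF B[of 1] C[of 2]] by simp
  moreover have "(\<lambda>n. 2 * B 2 n * C 1 n) \<longlonglongrightarrow> 2 * theta (4 * s) * theta (1 / s)"
    using tendsto_mult[OF tendsto_mult[OF tendsto_const[of 2] B[of 2]] C[of 1]] by simp
  ultimately show ?thesis
    using Lim_transform_eventually[OF _ ev] LIMSEQ_unique by blast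
qed

section \<open>Modular equations\<close>

text \<open>The quotients \<open>\<theta>\<^sub>4 / \<theta>\<^sub>3\<close> and \<open>\<theta>\<^sub>2 / \<theta>\<^sub>3\<close>; their squares are the complementary elliptic modulus and the
  modulus.\<close>

definition ratio4 :: "real \<Rightarrow> real" where
  "ratio4 s = (theta (4 * s) - odd_theta s) / theta s"

definition ratio2 :: "real \<Rightarrow> real" where
  "ratio2 s = odd_theta (s / 4) / theta s"

lemma theta_split: "theta s = theta (4 * s) + odd_theta s"
  by (simp add: odd_theta_def)

lemma theta_pos: "s > 0 \<Longrightarrow> theta s > 0"
  using theta_ge_1[of s] by simp

lemma odd_theta_pos:
  assumes "s > 0"
  shows "odd_theta s > 0"
proof -
  have "exp (- (pi * s)) \<le> odd_theta s"
  proof (rule has_sum_mono2)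
    show "((\<lambda>m::int. exp (- (pi * s * (of_int m)\<^sup>2))) has_sum exp (- (pi * s))) {1}"
      by (rule has_sum_finiteI) auto
    show "((\<lambda>m::int. exp (- (pi * s * (of_int m)\<^sup>2))) has_sum odd_theta s) {m. odd m}"
      by (rule has_sum_theta_odd[OF assms])
  qed auto
  then show ?thesis
    using exp_gt_zero less_le_trans by blast
qed

text \<open>Eliminating \<open>odd_theta\<close> gives 2 theta (4 s) / theta s - 1 on the left and
  theta (1 / (4 s)) / theta (1 / s) - 1 on the right, so this is \<open>theta_inversion\<close>
  divided by theta values.\<close>

lemma ratio4_inversion:
  assumes "s > 0"
  shows "ratio4 s = ratio2 (1 / s)"
proof -
  have pos: "theta s > 0" "theta (1 / s) > 0"
    using assms by (auto intro: theta_pos)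
  have "ratio4 s = 2 * theta (4 * s) / theta s - 1"
    using pos by (simp add: ratio4_def odd_theta_def field_simps)
  also have "\<dots> = theta (1 / (4 * s)) / theta (1 / s) - 1"
    using theta_inversion[OF assms] pos by (simp add: field_simps)
  also have "\<dots> = ratio2 (1 / s)"
    using pos by (simp add: ratio2_def odd_theta_def field_simps)
  finally show ?thesis .
qed

lemma ratio2_inversion: "s > 0 \<Longrightarrow> ratio2 s = ratio4 (1 / s)"
  using ratio4_inversion[of "1 / s"] by simp

lemma ratio2_pos: "s > 0 \<Longrightarrow> ratio2 s > 0"
  by (simp add: ratio2_def odd_theta_pos theta_pos)

lemma ratio4_pos: "s > 0 \<Longrightarrow> ratio4 s > 0"
  by (simp add: ratio4_inversion ratio2_pos)

lemma ratio4_less_1: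
  assumes "s > 0"
  shows "ratio4 s < 1"
  using theta_pos[OF assms] odd_theta_pos[OF assms] theta_split[of s] by (simp add: ratio4_def)

lemma ratio2_less_1: "s > 0 \<Longrightarrow> ratio2 s < 1"
  by (simp add: ratio2_inversion ratio4_less_1)

section \<open>Duplication formulas and Jacobi's quartic identity\<close>

text \<open>\<open>theta_double\<close> at s / 2 and at s expresses the left side as (a + b)^2 -
  (a^2 + b^2), where a and b are the even and odd parts of \<open>theta s\<close>.\<close>

lemma odd_theta_half:
  assumes "s > 0"
  shows "(odd_theta (s / 2))\<^sup>2 = 2 * theta (4 * s) * odd_theta s"
proof -
  have "(theta s)\<^sup>2 = (theta (2 * s))\<^sup>2 + (odd_theta (s / 2))\<^sup>2"
    using theta_double[of "s / 2"] assms by simp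
  with theta_double[OF assms] theta_split[of s] show ?thesis
    by (simp add: power2_eq_square algebra_simps)
qed

lemma theta4_double:
  assumes "s > 0"
  shows "(theta (8 * s) - odd_theta (2 * s))\<^sup>2 = (theta (4 * s))\<^sup>2 - (odd_theta s)\<^sup>2"
  using theta_double[OF assms] theta_double[of "2 * s"] theta_split[of "2 * s"] assms
  by (simp add: power2_eq_square algebra_simps)

text \<open>Landen's transformation k'(q^2) = 2 sqrt k' / (1 + k') and k(q^2) = (1 - k') / (1 + k'):
  every quantity is rational in the even and odd parts a, b of \<open>theta s\<close>.\<close>

lemma ratio4_double:
  assumes "s > 0"
  shows "(ratio4 (2 * s))\<^sup>2 * (1 + (ratio4 s)\<^sup>2) = 2 * ratio4 s"
    and ratio2_double: "(ratio2 (2 * s))\<^sup>2 * (1 + (ratio4 s)\<^sup>2) = 1 - (ratio4 s)\<^sup>2"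
proof -
  define a b where "a = theta (4 * s)" and "b = odd_theta s"
  have pos: "a > 0" "b > 0"
    using assms by (auto simp: a_def b_def intro: theta_pos odd_theta_pos)
  have th: "theta s = a + b" "(theta (2 * s))\<^sup>2 = a\<^sup>2 + b\<^sup>2"
    using theta_split[of s] theta_double[OF assms] by (auto simp: a_def b_def)
  have r: "ratio4 s = (a - b) / (a + b)"
    by (simp add: ratio4_def th a_def b_def)
  have r4: "(ratio4 (2 * s))\<^sup>2 = (a\<^sup>2 - b\<^sup>2) / (a\<^sup>2 + b\<^sup>2)"
    using theta4_double[OF assms] by (simp add: ratio4_def power_divide th) (simp add: a_def b_def)
  have r2: "(ratio2 (2 * s))\<^sup>2 = 2 * a * b / (a\<^sup>2 + b\<^sup>2)"
    using odd_theta_half[OF assms] by (simp add: ratio2_def power_divide th) (simp add: a_def b_def)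
  have nz: "a + b \<noteq> 0" "a\<^sup>2 + b\<^sup>2 \<noteq> 0"
    using pos by (auto simp: add_pos_pos less_imp_neq[symmetric])
  have e: "1 + (ratio4 s)\<^sup>2 = 2 * (a\<^sup>2 + b\<^sup>2) / (a + b)\<^sup>2" "1 - (ratio4 s)\<^sup>2 = 4 * a * b / (a + b)\<^sup>2"
    using nz by (simp_all add: r power_divide divide_simps) (simp_all add: power2_eq_square algebra_simps)
  show "(ratio4 (2 * s))\<^sup>2 * (1 + (ratio4 s)\<^sup>2) = 2 * ratio4 s"
    unfolding e r4 using nz by (simp add: r divide_simps) (simp add: power2_eq_square algebra_simps)
  show "(ratio2 (2 * s))\<^sup>2 * (1 + (ratio4 s)\<^sup>2) = 1 - (ratio4 s)\<^sup>2"
    unfolding e r2 using nz by (simp add: divide_simps)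
qed

text \<open>Jacobi's identity k^2 + k'^2 = 1. Landen's transformation from s / 2 parametrizes it by
  (1 - r^2)^2 + (2 r)^2 = (1 + r^2)^2.\<close>

lemma ratio_quartic:
  assumes "s > 0"
  shows "(ratio2 s) ^ 4 + (ratio4 s) ^ 4 = 1"
proof -
  define r where "r = ratio4 (s / 2)"
  have 1: "(ratio4 s)\<^sup>2 * (1 + r\<^sup>2) = 2 * r" and 2: "(ratio2 s)\<^sup>2 * (1 + r\<^sup>2) = 1 - r\<^sup>2"
    using ratio4_double[of "s / 2"] ratio2_double[of "s / 2"] assms by (auto simp: r_def)
  have nz: "1 + r\<^sup>2 > 0" by (simp add: add_pos_nonneg)
  have "((ratio2 s)\<^sup>2 * (1 + r\<^sup>2))\<^sup>2 + ((ratio4 s)\<^sup>2 * (1 + r\<^sup>2))\<^sup>2 = (1 + r\<^sup>2)\<^sup>2"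
    unfolding 1 2 by (simp add: power2_eq_square algebra_simps)
  then have "((ratio2 s) ^ 4 + (ratio4 s) ^ 4) * (1 + r\<^sup>2)\<^sup>2 = 1 * (1 + r\<^sup>2)\<^sup>2"
    by (simp add: power_mult_distrib distrib_right flip: power_mult)
  with nz show ?thesis by simp
qed

section \<open>Modular equations of degrees 3 and 7\<close>

text \<open>Legendre's equation sqrt (k l) + sqrt (k' l') = 1. With even and odd parts a, b and a',
  b', the difference (a + b) (a' + b') - (a - b) (a' - b') is 2 (a b' + b a'), which
  \<open>odd_theta_3\<close> identifies as a product of theta_2 values.\<close>

lemma ratio_degree_3:
  assumes "s > 0"
  shows "ratio2 s * ratio2 (3 * s) + ratio4 s * ratio4 (3 * s) = 1"
proof -
  have pos: "theta s > 0" "theta (3 * s) > 0"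
    using assms by (auto intro: theta_pos)
  have "odd_theta (s / 4) * odd_theta (3 * s / 4) =
    2 * (theta (4 * s) * odd_theta (3 * s) + odd_theta s * theta (12 * s))"
    using odd_theta_3[of "s / 4"] assms by simp
  then have "odd_theta (s / 4) * odd_theta (3 * s / 4) +
      (theta (4 * s) - odd_theta s) * (theta (4 * (3 * s)) - odd_theta (3 * s)) = theta s * theta (3 * s)"
    using theta_split[of s] theta_split[of "3 * s"] by (simp add: algebra_simps)
  then show ?thesis
    using pos by (simp add: ratio2_def ratio4_def add_divide_distrib[symmetric])
qed

text \<open>The square of (k' l')^(1/4) = 1 - (k l)^(1/4). It follows from
  \<open>odd_theta_7\<close> in the same way as the cubic case.\<close>

lemma ratio_degree_7:
  assumes "s > 0"
  shows "(1 - sqrt (ratio2 s * ratio2 (7 * s)))\<^sup>2 = ratio4 s * ratio4 (7 * s)"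
proof -
  define W where "W = ratio2 s * ratio2 (7 * s)"
  have pos: "theta s > 0" "theta (7 * s) > 0" "W > 0"
    using assms by (auto simp: W_def intro!: theta_pos ratio2_pos mult_pos_pos)
  \<comment> \<open>\<open>odd_theta (t / 8)\<close> is theta_2 at the square root of the nome. Its
    square is 2 theta_2 theta_3, which is the source of the square root of \<open>W\<close>.\<close>
  have sq: "(odd_theta (t / 8))\<^sup>2 = 2 * (theta t)\<^sup>2 * ratio2 t" if "t > 0" for t
    using odd_theta_half[of "t / 4"] theta_pos[OF that] that
    by (simp add: ratio2_def power2_eq_square)
  have "(odd_theta (s / 8) * odd_theta (7 * s / 8))\<^sup>2 = (2 * theta s * theta (7 * s))\<^sup>2 * W"
    unfolding power_mult_distrib using sq[of s] sq[of "7 * s"] assms by (simp add: W_def)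
  also have "\<dots> = (2 * theta s * theta (7 * s) * sqrt W)\<^sup>2"
    using pos by (simp add: power_mult_distrib)
  finally have "odd_theta (s / 8) * odd_theta (7 * s / 8) = 2 * theta s * theta (7 * s) * sqrt W"
    using pos assms by (subst (asm) power2_eq_iff_nonneg) (auto intro!: mult_pos_pos less_imp_le odd_theta_pos)
  moreover have "odd_theta (s / 8) * odd_theta (7 * s / 8) =
    2 * (theta (4 * s) * odd_theta (7 * s) + odd_theta s * theta (28 * s))
    + odd_theta (s / 4) * odd_theta (7 * s / 4)"
    using odd_theta_7[of "s / 8"] assms by simp
  ultimately have "theta s * theta (7 * s) - 2 * theta s * theta (7 * s) * sqrt W
     + odd_theta (s / 4) * odd_theta (7 * s / 4)
      = (theta (4 * s) - odd_theta s) * (theta (4 * (7 * s)) - odd_theta (7 * s))"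
    using theta_split[of s] theta_split[of "7 * s"] by (simp add: algebra_simps)
  moreover have "odd_theta (s / 4) * odd_theta (7 * s / 4) = W * (theta s * theta (7 * s))"
    using pos by (simp add: W_def ratio2_def)
  ultimately have "(1 - 2 * sqrt W + W) * (theta s * theta (7 * s)) =
      (theta (4 * s) - odd_theta s) * (theta (4 * (7 * s)) - odd_theta (7 * s))"
    by (simp add: algebra_simps)
  then have "1 - 2 * sqrt W + W = ratio4 s * ratio4 (7 * s)"
    using pos by (simp add: ratio4_def field_simps)
  moreover have "(1 - sqrt W)\<^sup>2 = 1 - 2 * sqrt W + W"
    using pos by (simp add: power2_diff)
  ultimately show ?thesis by (simp add: W_def)
qed

section \<open>Separating the modulus from its complement\<close>

text \<open>A nome x < 1/3 suffices, since comparison with the geometric series gives theta \<le> 1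
  + 2 x / (1 - x) < 2.\<close>

lemma theta_less_2:
  assumes "s \<ge> 0.43"
  shows "theta s < 2"
proof -
  define x where "x = exp (- (pi * s))"
  have "3 * 0.43 \<le> pi * s"
    using assms pi_gt3 by (intro mult_mono) auto
  then have "1 + 1.29 + 1.29\<^sup>2 / 2 \<le> exp (pi * s)"
  proof -
    have "1 + 1.29 + 1.29\<^sup>2 / 2 \<le> exp (1.29 :: real)"
      by (rule exp_lower_Taylor_quadratic) simp
    also have "\<dots> \<le> exp (pi * s)"
      using \<open>3 * 0.43 \<le> pi * s\<close> by simp
    finally show ?thesis .
  qed
  then have "exp (pi * s) > 3" by (simp add: power2_eq_square)
  then have x: "0 < x" "x < 1 / 3"
    by (auto simp: x_def exp_minus field_simps)
  have s: "s > 0" using assms by simp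
  have "(\<Sum>k. exp (- (pi * s * (real (Suc k))\<^sup>2))) \<le> (\<Sum>k. x * x ^ k)"
  proof (intro suminf_le summable_gauss s summable_mult summable_geometric)
    fix k
    have "real (Suc k) \<le> (real (Suc k))\<^sup>2"
      by (simp add: power2_eq_square)
    then have "pi * s * real (Suc k) \<le> pi * s * (real (Suc k))\<^sup>2"
      using s by (intro mult_left_mono) auto
    then have "exp (- (pi * s * (real (Suc k))\<^sup>2)) \<le> exp (real (Suc k) * - (pi * s))"
      by (simp add: mult.commute)
    also have "\<dots> = x ^ Suc k" by (simp only: exp_of_nat_mult x_def)
    finally show "exp (- (pi * s * (real (Suc k))\<^sup>2)) \<le> x * x ^ k" by simp
  qed (use x in auto)
  also have "(\<Sum>k. x * x ^ k) = x / (1 - x)"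
    using x by (simp add: suminf_mult suminf_geometric)
  also have "\<dots> < 1 / 2" using x by (simp add: field_simps)
  finally show ?thesis
    by (simp add: theta_suminf[OF s] del: of_nat_Suc)
qed

text \<open>This selects the larger root when k and k' are known only through symmetric functions.
  The numerators are theta (s / 4) - theta s and 2 theta (4 s) - theta s, so theta (s / 4) < 2 \<le>
  2 theta (4 s) decides.\<close>

lemma ratio2_less_ratio4:
  assumes "s \<ge> sqrt 3"
  shows "ratio2 s < ratio4 s"
proof -
  \<comment> \<open>The constant 0.43 of \<open>theta_less_2\<close> is 1.72 / 4, with 1.72 just
    below sqrt 3.\<close>
  have "sqrt (1.72\<^sup>2) \<le> sqrt 3" by (intro real_sqrt_le_mono) (simp add: power2_eq_square)
  then have s: "s \<ge> 1.72" using assms by simp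
  have "theta (s / 4) < 2" "theta (4 * s) \<ge> 1"
    using s by (auto intro!: theta_less_2 theta_ge_1)
  moreover have "theta s > 0" using s by (intro theta_pos) simp
  ultimately show ?thesis
    unfolding ratio2_def ratio4_def by (intro divide_strict_right_mono) (auto simp: odd_theta_def)
qed

section \<open>Singular values\<close>

text \<open>Odd squares are (2 k + 1)^2 = 1 + 8 * (k (k + 1) / 2), and the positive and negative odd
  integers contribute equally.\<close>

lemma theta_psi_exp:
  assumes "s > 0"
  shows "2 * exp (- (pi * s)) * theta_psi (exp (- (8 * pi * s))) = odd_theta s"
proof -
  let ?g = "\<lambda>m::int. exp (- (pi * s * (of_int m)\<^sup>2))"
  have odd: "(?g has_sum odd_theta s) {m. odd m}" by (rule has_sum_theta_odd[OF assms])
  have "?g summable_on {m. odd m \<and> m > 0}"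
    by (rule summable_on_subset_banach[OF has_sum_imp_summable[OF odd]]) auto
  then obtain S where S: "(?g has_sum S) {m. odd m \<and> m > 0}"
    by (auto simp: summable_on_def)
  then have "(?g has_sum S) {m. odd m \<and> m < 0}"
    by (subst (asm) has_sum_reindex_bij_witness[where i = uminus and j = uminus
          and h = ?g and s' = S and T = "{m. odd m \<and> m < 0}"]) auto
  with S have "(?g has_sum (S + S)) ({m. odd m \<and> m > 0} \<union> {m. odd m \<and> m < 0})"
    by (rule has_sum_Un_disjoint) auto
  moreover have "{m. odd m \<and> m > 0} \<union> {m. odd m \<and> m < 0} = {m::int. odd m}"
    by (auto simp: not_less order_le_less)
  ultimately have S2: "odd_theta s = 2 * S"
    using odd has_sum_unique by fastforce
  have "((\<lambda>k::nat. ?g (2 * int k + 1)) has_sum S) UNIV"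
    using S by (subst has_sum_reindex_bij_witness[where i = "\<lambda>m. nat ((m - 1) div 2)"
          and j = "\<lambda>k. 2 * int k + 1" and h = ?g and s' = S and T = "{m. odd m \<and> m > 0}"])
        (auto elim!: oddE)
  then have "(\<lambda>k::nat. ?g (2 * int k + 1)) sums S"
    by (rule has_sum_imp_sums)
  moreover have "?g (2 * int k + 1) = exp (- (pi * s)) * exp (- (8 * pi * s)) ^ (k * (k + 1) div 2)" for k
  proof -
    define N where "N = k * (k + 1) div 2"
    have "2 * N = k * (k + 1)" by (simp add: N_def)
    then have "2 * real N = real k * (real k + 1)"
      by (metis of_nat_1 of_nat_add of_nat_mult of_nat_numeral)
    then have sq: "(2 * real k + 1)\<^sup>2 = 1 + 8 * real N"
      by (simp add: power2_eq_square algebra_simps)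
    show ?thesis
      unfolding N_def[symmetric]
      by (simp only: of_int_add of_int_mult of_int_of_nat_eq of_int_numeral of_int_1 sq
          exp_of_nat_mult[symmetric] exp_add[symmetric]) (simp add: algebra_simps)
  qed
  ultimately have "(\<lambda>k. exp (- (pi * s)) * exp (- (8 * pi * s)) ^ (k * (k + 1) div 2)) sums S"
    by simp
  then have "(\<lambda>k. exp (- (pi * s)) * exp (- (8 * pi * s)) ^ (k * (k + 1) div 2) / exp (- (pi * s)))
      sums (S / exp (- (pi * s)))"
    by (rule sums_divide)
  then have "(\<lambda>k. exp (- (8 * pi * s)) ^ (k * (k + 1) div 2)) sums (S / exp (- (pi * s)))"
    by simp
  then have "theta_psi (exp (- (8 * pi * s))) = S / exp (- (pi * s))"
    by (simp add: theta_psi_def sums_iff)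
  with S2 show ?thesis by simp
qed

lemma A_4_eq:
  assumes "n > 0"
  shows "A 4 n = sqrt 2 * ratio4 (sqrt n / 2) / (1 - ratio4 (sqrt n / 2))"
proof -
  define s where "s = sqrt n / 2"
  have s: "s > 0" using assms by (simp add: s_def)
  have "sqrt (n / 4) = s" by (simp add: s_def real_sqrt_divide)
  moreover have "(4::real) powr (1 / 4) = sqrt 2"
  proof -
    have "(4::real) powr (1 / 4) = (2 powr 2) powr (1 / 4)" by simp
    also have "\<dots> = sqrt 2" unfolding powr_powr by (simp add: powr_half_sqrt)
    finally show ?thesis .
  qed
  moreover have "exp (- pi * s) powr 8 = exp (- (8 * pi * s))"
    by (simp add: powr_def)
  ultimately have "A 4 n = theta_phi (- exp (- (pi * s))) /
      (sqrt 2 * (2 * exp (- (pi * s)) * theta_psi (exp (- (8 * pi * s)))))"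
    by (simp add: A_def Let_def mult_ac)
  also have "\<dots> = (theta (4 * s) - odd_theta s) / (sqrt 2 * odd_theta s)"
    unfolding theta_psi_exp[OF s] theta_phi_minus[OF s] ..
  also have "\<dots> = sqrt 2 * ratio4 s / (1 - ratio4 s)"
  proof -
    have 1: "1 - ratio4 s = 2 * odd_theta s / theta s"
      using theta_pos[OF s] theta_split[of s] by (simp add: ratio4_def field_simps)
    have "x / (sqrt 2 * y) = sqrt 2 * x / (2 * y)" for x y :: real
    proof -
      have "sqrt 2 * (sqrt 2 * y) = 2 * y" by simp
      then have "sqrt 2 * x / (2 * y) = sqrt 2 * x / (sqrt 2 * (sqrt 2 * y))" by (simp only:)
      also have "\<dots> = x / (sqrt 2 * y)" by (rule mult_divide_mult_cancel_left) simp
      finally show ?thesis ..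
    qed
    then show ?thesis
      unfolding 1 using theta_pos[OF s] by (simp add: ratio4_def)
  qed
  finally show ?thesis by (simp add: s_def)
qed

text \<open>For r = \<open>ratio4 (sqrt n / 2)\<close> the value Y = sqrt 2 * r / (1 - r) satisfies
  Y^2 + sqrt 2 * Y = 2 r / (1 - r)^2, which equals K / (1 - K) by Landen's transformation. This
  quadratic has only one positive root.\<close>

lemma A_4_eqI:
  assumes "n > 0" and K: "K = (ratio4 (sqrt n))\<^sup>2" and X: "X > 0" "(X\<^sup>2 + sqrt 2 * X) * (1 - K) = K"
  shows "A 4 n = X"
proof -
  define r where "r = ratio4 (sqrt n / 2)"
  have r: "0 < r" "r < 1"
    using assms by (auto simp: r_def intro: ratio4_pos ratio4_less_1)
  define Y where "Y = sqrt 2 * r / (1 - r)"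
  have "Y > 0" using r by (simp add: Y_def)
  have A: "A 4 n = Y" using A_4_eq[OF assms(1)] by (simp add: Y_def r_def)
  have K1: "K * (1 + r\<^sup>2) = 2 * r"
    using ratio4_double[of "sqrt n / 2"] assms by (simp add: r_def)
  have Y2: "(Y\<^sup>2 + sqrt 2 * Y) * (1 - r)\<^sup>2 = 2 * r"
  proof -
    have Yr: "Y * (1 - r) = sqrt 2 * r" using r by (simp add: Y_def)
    have "(Y\<^sup>2 + sqrt 2 * Y) * (1 - r)\<^sup>2 = (Y * (1 - r))\<^sup>2 + sqrt 2 * (Y * (1 - r)) * (1 - r)"
      by (simp add: power2_eq_square algebra_simps)
    then show ?thesis
      unfolding Yr by (simp add: power_mult_distrib) (simp add: power2_eq_square algebra_simps)
  qed
  have nz: "1 + r\<^sup>2 > 0" by (simp add: add_pos_nonneg)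
  have K2: "(1 - K) * (1 + r\<^sup>2) = (1 - r)\<^sup>2"
    using K1 by (simp add: power2_eq_square algebra_simps)
  have "(X\<^sup>2 + sqrt 2 * X) * (1 - r)\<^sup>2 = (X\<^sup>2 + sqrt 2 * X) * (1 - K) * (1 + r\<^sup>2)"
    by (simp only: K2 mult.assoc)
  also have "\<dots> = (Y\<^sup>2 + sqrt 2 * Y) * (1 - r)\<^sup>2"
    by (simp only: X K1 Y2)
  finally have "X\<^sup>2 + sqrt 2 * X = Y\<^sup>2 + sqrt 2 * Y"
    using r by simp
  then have "(X - Y) * (X + Y + sqrt 2) = 0"
    by (simp add: power2_eq_square algebra_simps)
  moreover have "X + Y + sqrt 2 > 0" using X \<open>Y > 0\<close> by (simp add: add_pos_pos)
  ultimately show ?thesis using A by simp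
qed

text \<open>At 4 n the quotient in \<open>A_4_eq\<close> is U = \<open>ratio4 (sqrt n)\<close>
  itself, with U^2 = K. Rationalizing sqrt 2 * U / (1 - U) gives sqrt 2 * K / (1 - K) + sqrt 2 * U /
  (1 - K); p and q are the squares of these summands.\<close>

lemma A_4_times_4_eqI:
  assumes "n > 0" and K: "K = (ratio4 (sqrt n))\<^sup>2"
    and p: "p * (1 - K)\<^sup>2 = 2 * K\<^sup>2" and q: "q * (1 - K)\<^sup>2 = 2 * K"
  shows "A 4 (4 * n) = sqrt p + sqrt q"
proof -
  define U where "U = ratio4 (sqrt n)"
  have U: "0 < U" "U < 1"
    using assms by (auto simp: U_def intro: ratio4_pos ratio4_less_1)
  have KU: "K = U\<^sup>2" by (simp add: K U_def)
  have "U\<^sup>2 < 1" using U by (simp add: power_less_one_iff)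
  then have K1: "K < 1" "0 < K" using U by (auto simp: KU)
  have "sqrt p = sqrt 2 * K / (1 - K)"
  proof (rule real_sqrt_unique)
    show "(sqrt 2 * K / (1 - K))\<^sup>2 = p"
      using p K1 by (simp add: power_divide power_mult_distrib field_simps)
  qed (use K1 in simp)
  moreover have "sqrt q = sqrt 2 * U / (1 - K)"
  proof (rule real_sqrt_unique)
    show "(sqrt 2 * U / (1 - K))\<^sup>2 = q"
      using q K1 by (simp add: power_divide power_mult_distrib field_simps KU)
  qed (use K1 U in simp)
  moreover have "A 4 (4 * n) = sqrt 2 * U / (1 - U)"
    using A_4_eq[of "4 * n"] assms by (simp add: U_def real_sqrt_mult)
  moreover have "1 - K = (1 - U) * (1 + U)"
    by (simp add: KU power2_eq_square algebra_simps)
  moreover have "sqrt 2 * U / (1 - U) = sqrt 2 * U * (U + 1) / ((1 - U) * (1 + U))"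
    using U by (simp add: add.commute)
  ultimately show ?thesis
    using U by (simp add: KU power2_eq_square add_divide_distrib algebra_simps)
qed

section \<open>Complementary moduli at special arguments\<close>

lemma sum_prod_solve:
  fixes K k c :: real
  assumes "K\<^sup>2 + k\<^sup>2 = 1" "K * k = c" "0 < k" "k < K"
  shows "K = (sqrt (1 + 2 * c) + sqrt (1 - 2 * c)) / 2"
proof -
  have "sqrt (1 + 2 * c) = K + k"
    using assms by (intro real_sqrt_unique) (auto simp: power2_eq_square algebra_simps)
  moreover have "sqrt (1 - 2 * c) = K - k"
    using assms by (intro real_sqrt_unique) (auto simp: power2_eq_square algebra_simps)
  ultimately show ?thesis by simp
qed

lemma ratio_squares:
  assumes "s > 0"
  shows "((ratio4 s)\<^sup>2)\<^sup>2 + ((ratio2 s)\<^sup>2)\<^sup>2 = 1"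
  using ratio_quartic[OF assms] by (simp flip: power_mult)

lemma ratio4_1: "(ratio4 1)\<^sup>2 = sqrt 2 / 2" 
proof -
  have "ratio4 1 = ratio2 1" using ratio4_inversion[of 1] by simp
  then have "((ratio4 1)\<^sup>2)\<^sup>2 = 1 / 2" using ratio_squares[of 1] by simp
  then have "((ratio4 1)\<^sup>2)\<^sup>2 = (sqrt 2 / 2)\<^sup>2" by (simp add: power_divide)
  then show ?thesis by (subst (asm) power2_eq_iff_nonneg) auto
qed

text \<open>Since sqrt 2 is twice its own inverse, Landen's transformation from 1 / sqrt 2 becomes a
  relation between k and k' at the single argument sqrt 2.\<close>

lemma ratio4_sqrt_2:
  defines "K \<equiv> (ratio4 (sqrt 2))\<^sup>2"
  shows "K\<^sup>2 = 2 * sqrt 2 - 2" "0 < K"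
proof -
  define x where "x = (ratio2 (sqrt 2))\<^sup>2"
  have v: "ratio4 (sqrt 2 / 2) = ratio2 (sqrt 2)"
  proof -
    have "1 / sqrt 2 = sqrt 2 / 2" by (simp add: field_simps)
    moreover have "ratio2 (sqrt 2) = ratio4 (1 / sqrt 2)"
      by (rule ratio2_inversion) simp
    ultimately show ?thesis by (simp only:)
  qed
  have x: "0 < x" using ratio2_pos[of "sqrt 2"] by (simp add: x_def)
  have K0: "K\<^sup>2 + x\<^sup>2 = 1" using ratio_squares[of "sqrt 2"] by (simp add: K_def x_def)
  have "K * (1 + x) = 2 * ratio2 (sqrt 2)"
    using ratio4_double[of "sqrt 2 / 2"] v by (simp add: K_def x_def)
  then have "(K * (1 + x))\<^sup>2 = 4 * x" by (simp add: power_mult_distrib x_def)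
  moreover have "K\<^sup>2 = 1 - x\<^sup>2" using K0 by simp
  ultimately have "(1 - x\<^sup>2) * (1 + x)\<^sup>2 = 4 * x" by (simp add: power_mult_distrib)
  \<comment> \<open>The quartic in x = k factors, and its positive root is sqrt 2 - 1.\<close>
  then have "(1 + x\<^sup>2) * (2 - (1 + x)\<^sup>2) = 0"
    by (simp add: power2_eq_square algebra_simps)
  moreover have "1 + x\<^sup>2 > 0" by (simp add: add_pos_nonneg)
  ultimately have "(1 + x)\<^sup>2 = 2" by simp
  then have "sqrt 2 = 1 + x" using x by (intro real_sqrt_unique) auto
  then have "x = sqrt 2 - 1" by simp
  with K0 show "K\<^sup>2 = 2 * sqrt 2 - 2" by (simp add: power2_diff)
  show "0 < K" using ratio4_pos[of "sqrt 2"] by (simp add: K_def)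
qed

lemma ratio_sqrt_inverse:
  assumes "N > 0"
  shows "ratio4 (1 / sqrt N) = ratio2 (sqrt N)" "ratio2 (1 / sqrt N) = ratio4 (sqrt N)"
  using assms ratio2_inversion[of "sqrt N"] ratio4_inversion[of "sqrt N"] by simp_all

text \<open>At s = 1 / sqrt 3 the arguments s and 3 s are inverse to each other, so both terms of
  the degree 3 equation coincide. Hence sqrt (k k') = 1/2 at sqrt 3.\<close>

lemma ratio4_sqrt_3: "(ratio4 (sqrt 3))\<^sup>2 = (sqrt 2 * sqrt 3 + sqrt 2) / 4"
proof -
  have "ratio2 (sqrt 3) * ratio4 (sqrt 3) = 1 / 2"
    using ratio_degree_3[of "1 / sqrt 3"] ratio_sqrt_inverse[of 3] real_div_sqrt[of 3]
    by (simp add: mult.commute)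
  then have "(ratio2 (sqrt 3) * ratio4 (sqrt 3))\<^sup>2 = (1 / 2)\<^sup>2" by simp
  then have "(ratio4 (sqrt 3))\<^sup>2 * (ratio2 (sqrt 3))\<^sup>2 = 1 / 4"
    by (simp add: power_mult_distrib power_divide mult.commute)
  moreover have "(ratio2 (sqrt 3))\<^sup>2 < (ratio4 (sqrt 3))\<^sup>2"
    using ratio2_less_ratio4[of "sqrt 3"] ratio2_pos[of "sqrt 3"] by (intro power_strict_mono) auto
  ultimately have "(ratio4 (sqrt 3))\<^sup>2 = (sqrt (1 + 2 * (1 / 4)) + sqrt (1 - 2 * (1 / 4))) / 2"
    using ratio_squares[of "sqrt 3"] ratio2_pos[of "sqrt 3"] by (intro sum_prod_solve) auto
  moreover have "sqrt (1 + 2 * (1 / 4)) = sqrt 2 * sqrt 3 / 2" "sqrt (1 - 2 * (1 / 4)) = sqrt 2 / 2"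
    by (rule real_sqrt_unique; simp add: power_mult_distrib power_divide)+
  ultimately show ?thesis by simp
qed

text \<open>At s = 1 / sqrt 7 both products in the degree 7 equation equal P = sqrt (k k'), and (1 -
  sqrt P)^2 = P gives k k' = 1/16.\<close>

lemma ratio4_sqrt_7: "(ratio4 (sqrt 7))\<^sup>2 = (3 * sqrt 2 + sqrt 2 * sqrt 7) / 8"
proof -
  define P where "P = ratio2 (sqrt 7) * ratio4 (sqrt 7)"
  have P: "P > 0" using ratio2_pos[of "sqrt 7"] ratio4_pos[of "sqrt 7"] by (simp add: P_def)
  have "(1 - sqrt P)\<^sup>2 = P"
    using ratio_degree_7[of "1 / sqrt 7"] ratio_sqrt_inverse[of 7] real_div_sqrt[of 7]
    by (simp add: P_def mult.commute)
  then have "(1 - sqrt P)\<^sup>2 = (sqrt P)\<^sup>2" using P by simp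
  then have "sqrt P = 1 / 2" by (simp add: power2_eq_square algebra_simps)
  then have "(sqrt P)\<^sup>2 = (1 / 2)\<^sup>2" by (rule arg_cong)
  then have "P = 1 / 4" using P by (simp add: power_divide)
  then have "P\<^sup>2 = (1 / 4)\<^sup>2" by simp
  then have "(ratio4 (sqrt 7))\<^sup>2 * (ratio2 (sqrt 7))\<^sup>2 = 1 / 16"
    by (simp add: P_def power_mult_distrib power_divide mult.commute)
  moreover have "(ratio2 (sqrt 7))\<^sup>2 < (ratio4 (sqrt 7))\<^sup>2"
    using ratio2_less_ratio4[of "sqrt 7"] ratio2_pos[of "sqrt 7"] by (intro power_strict_mono) auto
  ultimately have "(ratio4 (sqrt 7))\<^sup>2 = (sqrt (1 + 2 * (1 / 16)) + sqrt (1 - 2 * (1 / 16))) / 2"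
    using ratio_squares[of "sqrt 7"] ratio2_pos[of "sqrt 7"] by (intro sum_prod_solve) auto
  moreover have "sqrt (1 + 2 * (1 / 16)) = 3 * sqrt 2 / 4" "sqrt (1 - 2 * (1 / 16)) = sqrt 2 * sqrt 7 / 4"
    by (rule real_sqrt_unique; simp add: power_mult_distrib power_divide)+
  ultimately show ?thesis by simp
qed

text \<open>The degree 3 equation at s = 1, where both quotients equal 2^(-1/4), yields u + w =
  2^(1/4). Together with u^4 + w^4 = 1 this determines u^2. The number r is (3/4)^(1/4).\<close>

lemma ratio4_3:
  fixes r :: real
  assumes r: "r > 0" "r\<^sup>2 = sqrt 3 / 2"
  shows "(ratio4 3)\<^sup>2 = sqrt 2 * (sqrt 3 - 1) * (1 + r) / 2"
proof -
  define u w v where "u = ratio4 3" and "w = ratio2 3" and "v = ratio4 1"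
  have pos: "0 < u" "0 < w" "u < 1" "w < 1" "0 < v"
    by (auto simp: u_def w_def v_def intro: ratio4_pos ratio2_pos ratio4_less_1 ratio2_less_1)
  have "sqrt 3 \<le> sqrt (3\<^sup>2)" by (rule real_sqrt_le_mono) simp
  then have "w < u" unfolding u_def w_def by (intro ratio2_less_ratio4) simp
  then have lt: "w\<^sup>2 < u\<^sup>2" using pos by (intro power_strict_mono) auto
  have "ratio2 1 = v" using ratio4_inversion[of 1] by (simp add: v_def)
  then have "v * (w + u) = 1"
    using ratio_degree_3[of 1] by (simp add: u_def w_def v_def distrib_left)
  then have "v\<^sup>2 * (w + u)\<^sup>2 = 1" by (metis power_mult_distrib power_one)
  then have "sqrt 2 * (w + u)\<^sup>2 = 2" using ratio4_1 by (simp add: v_def)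
  then have "(w + u)\<^sup>2 = 2 / sqrt 2" by (simp add: eq_divide_eq mult.commute)
  then have wu: "(w + u)\<^sup>2 = sqrt 2" by (simp only: real_div_sqrt zero_le_numeral)
  define p where "p = w * u"
  have sum: "w\<^sup>2 + u\<^sup>2 = sqrt 2 - 2 * p"
    using wu by (simp add: p_def power2_sum)
  have q: "(u\<^sup>2)\<^sup>2 + (w\<^sup>2)\<^sup>2 = 1" using ratio_squares[of 3] by (simp add: u_def w_def)
  have "(w\<^sup>2 + u\<^sup>2)\<^sup>2 = 1 + 2 * p\<^sup>2"
    using q by (simp add: power2_sum p_def power_mult_distrib)
  then have "(sqrt 2 - 2 * p)\<^sup>2 = 1 + 2 * p\<^sup>2" by (simp only: sum)
  \<comment> \<open>A quadratic equation for p = u w; the bound p < 1 < sqrt 2 selects the smaller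
    root.\<close>
  then have "(sqrt 2 - p)\<^sup>2 = 3 / 2" by (simp add: power2_diff power_mult_distrib)
  moreover have "p < 1" using pos mult_strict_mono[of w 1 u 1] by (simp add: p_def)
  moreover have "sqrt 2 > 1" by simp
  ultimately have "sqrt (3 / 2) = sqrt 2 - p" by (intro real_sqrt_unique) (auto simp del: real_sqrt_gt_1_iff)
  moreover have "sqrt (3 / 2) = sqrt 2 * sqrt 3 / 2"
    by (rule real_sqrt_unique) (simp_all add: power_mult_distrib power_divide)
  ultimately have s: "w\<^sup>2 + u\<^sup>2 = sqrt 2 * sqrt 3 - sqrt 2" using sum by simp
  have "(u\<^sup>2 - w\<^sup>2)\<^sup>2 = 2 * ((u\<^sup>2)\<^sup>2 + (w\<^sup>2)\<^sup>2) - (w\<^sup>2 + u\<^sup>2)\<^sup>2"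
    by (simp add: power2_diff power2_sum)
  also have "\<dots> = 4 * sqrt 3 - 6"
    unfolding s q by (simp add: power2_diff power_mult_distrib mult.left_commute)
  also have "\<dots> = (sqrt 2 * (sqrt 3 - 1) * r)\<^sup>2"
    unfolding power_mult_distrib r by (simp add: power2_diff algebra_simps)
  finally have "u\<^sup>2 - w\<^sup>2 = sqrt 2 * (sqrt 3 - 1) * r"
    using lt r by (subst (asm) power2_eq_iff_nonneg) auto
  with s have "2 * u\<^sup>2 = sqrt 2 * (sqrt 3 - 1) * (1 + r)" by (simp add: algebra_simps)
  then show ?thesis by (simp add: u_def)
qed

section \<open>Algebraic verification of the eight evaluations\<close>

theorem theorem4p2:
  fixes a :: real
  assumes "a = sqrt (1 + sqrt 2)"
  shows "A 4 2 = 1 + sqrt (1 + sqrt 2)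
    \<and> A 4 3 = (1 + sqrt 2) * (1 + sqrt 3) / sqrt 2
    \<and> A 4 4 = sqrt (8 + 6 * sqrt 2) + sqrt (6 + 4 * sqrt 2)
    \<and> A 4 7 = (3 + sqrt 7) * (4 + sqrt 14) / 2
    \<and> A 4 8 = sqrt (52 + 36 * sqrt 2 + (32 + 24 * sqrt 2) * a)
             + sqrt (56 + 40 * sqrt 2 + (36 + 26 * sqrt 2) * a)
    \<and> A 4 9 = sqrt (94 + 66 * sqrt 2 + 38 * sqrt 6 + 54 * sqrt 3)
             + sqrt (93 + 66 * sqrt 2 + 38 * sqrt 6 + 54 * sqrt 3)
    \<and> A 4 12 = sqrt (402 + 232 * sqrt 3 + 284 * sqrt 2 + 164 * sqrt 6)
              + sqrt (416 + 240 * sqrt 3 + 294 * sqrt 2 + 170 * sqrt 6)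
    \<and> A 4 28 = sqrt (2 * (64641 + 17276 * sqrt 14 + 24432 * sqrt 7 + 45708 * sqrt 2))
              + 2 * sqrt (32384 + 22899 * sqrt 2 + 12240 * sqrt 7 + 8655 * sqrt 14)"
proof -
  \<comment> \<open>Rules reducing polynomials in the radicals to a normal form; the second equation
    of each pair reaches squares inside right-nested products.\<close>
  have s2: "sqrt 2 * sqrt 2 = (2::real)" "sqrt 2 * (sqrt 2 * x) = 2 * x" for x :: real
    by simp_all
  have s3: "sqrt 3 * sqrt 3 = (3::real)" "sqrt 3 * (sqrt 3 * x) = 3 * x" for x :: real
    by simp_all
  have s7: "sqrt 7 * sqrt 7 = (7::real)" "sqrt 7 * (sqrt 7 * x) = 7 * x" for x :: real
    by simp_all
  have s6: "sqrt 6 = sqrt 2 * sqrt 3" and s14: "sqrt 14 = sqrt 2 * sqrt 7"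
    by (simp_all flip: real_sqrt_mult)
  have a0: "a > 1" using assms by simp
  have "a\<^sup>2 = 1 + sqrt 2" using assms by simp
  then have aa: "a * a = 1 + sqrt 2" "a * (a * x) = (1 + sqrt 2) * x" for x
    by (simp_all add: power2_eq_square flip: mult.assoc)
  \<comment> \<open>From K^2 = 2 (sqrt 2 - 1) = 2 / (1 + sqrt 2). Multiplying an equation by powers
    of a therefore eliminates K for n = 2 and n = 8.\<close>
  have K2: "(ratio4 (sqrt 2))\<^sup>2 * a = sqrt 2"
  proof -
    have "((ratio4 (sqrt 2))\<^sup>2 * a)\<^sup>2 = (sqrt 2)\<^sup>2"
      unfolding power_mult_distrib ratio4_sqrt_2 \<open>a\<^sup>2 = 1 + sqrt 2\<close> by (simp add: algebra_simps)
    then show ?thesis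
      using ratio4_sqrt_2(2) a0 by (subst (asm) power2_eq_iff_nonneg) auto
  qed
  have "A 4 2 = 1 + a"
  proof (rule A_4_eqI[OF _ refl])
    define K where "K = (ratio4 (sqrt 2))\<^sup>2"
    have "((1 + a)\<^sup>2 + sqrt 2 * (1 + a)) * (1 - K) * a = ((1 + a)\<^sup>2 + sqrt 2 * (1 + a)) * (a - K * a)"
      by (simp add: algebra_simps)
    also have "\<dots> = K * a"
      unfolding K2[folded K_def] by (simp add: power2_eq_square algebra_simps aa s2)
    finally show "((1 + a)\<^sup>2 + sqrt 2 * (1 + a)) * (1 - (ratio4 (sqrt 2))\<^sup>2) = (ratio4 (sqrt 2))\<^sup>2"
      using a0 by (simp add: K_def)
  qed (use a0 in auto)
  moreover have "A 4 3 = (1 + sqrt 2) * (1 + sqrt 3) / sqrt 2"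
  proof (rule A_4_eqI[OF _ ratio4_sqrt_3[symmetric]])
    have X: "(1 + sqrt 2) * (1 + sqrt 3) / sqrt 2 = (2 + sqrt 2) * (1 + sqrt 3) / 2"
      by (simp add: field_simps s2)
    show "(((1 + sqrt 2) * (1 + sqrt 3) / sqrt 2)\<^sup>2 + sqrt 2 * ((1 + sqrt 2) * (1 + sqrt 3) / sqrt 2)) *
      (1 - (sqrt 2 * sqrt 3 + sqrt 2) / 4) = (sqrt 2 * sqrt 3 + sqrt 2) / 4"
      unfolding X by (simp add: power2_eq_square field_simps s2 s3)
  qed (auto intro!: divide_pos_pos mult_pos_pos add_pos_pos)
  moreover have "A 4 (4 * 1) = sqrt (6 + 4 * sqrt 2) + sqrt (8 + 6 * sqrt 2)"
  proof (rule A_4_times_4_eqI)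
    show "sqrt 2 / 2 = (ratio4 (sqrt 1))\<^sup>2" by (simp add: ratio4_1)
  qed (simp_all add: power2_eq_square field_simps s2)
  moreover have "A 4 7 = (3 + sqrt 7) * (4 + sqrt 14) / 2"
  proof (rule A_4_eqI[OF _ ratio4_sqrt_7[symmetric]])
    show "(((3 + sqrt 7) * (4 + sqrt 14) / 2)\<^sup>2 + sqrt 2 * ((3 + sqrt 7) * (4 + sqrt 14) / 2)) *
      (1 - (3 * sqrt 2 + sqrt 2 * sqrt 7) / 8) = (3 * sqrt 2 + sqrt 2 * sqrt 7) / 8"
      unfolding s14 by (simp add: power2_eq_square field_simps s2 s7)
  qed (auto intro!: divide_pos_pos mult_pos_pos add_pos_pos)
  moreover have "A 4 (4 * 2) = sqrt (52 + 36 * sqrt 2 + (32 + 24 * sqrt 2) * a)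
             + sqrt (56 + 40 * sqrt 2 + (36 + 26 * sqrt 2) * a)"
  proof (rule A_4_times_4_eqI[OF _ refl])
    define K where "K = (ratio4 (sqrt 2))\<^sup>2"
    have Ka: "K * a = sqrt 2" using K2 by (simp add: K_def)
    have "(52 + 36 * sqrt 2 + (32 + 24 * sqrt 2) * a) * (1 - K)\<^sup>2 * a\<^sup>2
        = (52 + 36 * sqrt 2 + (32 + 24 * sqrt 2) * a) * (a - K * a)\<^sup>2"
      by (simp add: power2_eq_square algebra_simps)
    also have "\<dots> = 2 * (K * a)\<^sup>2"
      unfolding Ka by (simp add: power2_eq_square algebra_simps aa s2)
    finally show "(52 + 36 * sqrt 2 + (32 + 24 * sqrt 2) * a) * (1 - (ratio4 (sqrt 2))\<^sup>2)\<^sup>2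
        = 2 * ((ratio4 (sqrt 2))\<^sup>2)\<^sup>2"
      using a0 by (simp add: K_def power_mult_distrib)
    have "(56 + 40 * sqrt 2 + (36 + 26 * sqrt 2) * a) * (1 - K)\<^sup>2 * a\<^sup>2
        = (56 + 40 * sqrt 2 + (36 + 26 * sqrt 2) * a) * (a - K * a)\<^sup>2"
      by (simp add: power2_eq_square algebra_simps)
    also have "\<dots> = 2 * (K * a) * a"
      unfolding Ka by (simp add: power2_eq_square algebra_simps aa s2)
    also have "\<dots> = 2 * K * a\<^sup>2" by (simp add: power2_eq_square)
    finally show "(56 + 40 * sqrt 2 + (36 + 26 * sqrt 2) * a) * (1 - (ratio4 (sqrt 2))\<^sup>2)\<^sup>2
        = 2 * (ratio4 (sqrt 2))\<^sup>2"
      using a0 by (simp add: K_def)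
  qed simp
  moreover have "A 4 (3 * 3) = sqrt (94 + 66 * sqrt 2 + 38 * sqrt 6 + 54 * sqrt 3)
             + sqrt (93 + 66 * sqrt 2 + 38 * sqrt 6 + 54 * sqrt 3)"
  proof -
    define r where "r = sqrt (sqrt 3 / 2)"
    have r: "r > 0" "r\<^sup>2 = sqrt 3 / 2" by (simp_all add: r_def)
    then have rr: "r * r = sqrt 3 / 2" "r * (r * x) = sqrt 3 / 2 * x" for x
      by (simp_all add: power2_eq_square flip: mult.assoc)
    \<comment> \<open>Denested forms of the two radicals: the first lies in the field generated by
      sqrt 2 and sqrt 3, the second is r times an element of it. The equation for A then becomes
      polynomial in sqrt 2, sqrt 3 and r.\<close>
    let ?X = "5 + 3 * sqrt 2 + 3 * sqrt 3 + 2 * sqrt 2 * sqrt 3"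
    let ?Y = "r * (5 + 4 * sqrt 2 + 3 * sqrt 3 + 2 * sqrt 2 * sqrt 3)"
    have pos: "?X > 0" "?Y > 0"
      using r by (auto intro!: add_pos_pos mult_pos_pos)
    have "sqrt (94 + 66 * sqrt 2 + 38 * sqrt 6 + 54 * sqrt 3) = ?X"
      using pos by (intro real_sqrt_unique) (auto simp: s6 power2_eq_square algebra_simps s2 s3)
    moreover have "sqrt (93 + 66 * sqrt 2 + 38 * sqrt 6 + 54 * sqrt 3) = ?Y"
      using pos by (intro real_sqrt_unique) (auto simp: s6 power2_eq_square algebra_simps s2 s3 rr)
    moreover have "A 4 (3 * 3) = ?X + ?Y"
    proof (rule A_4_eqI[of _ "sqrt 2 * (sqrt 3 - 1) * (1 + r) / 2"])
      show "sqrt 2 * (sqrt 3 - 1) * (1 + r) / 2 = (ratio4 (sqrt (3 * 3)))\<^sup>2"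
        using ratio4_3[OF r] by simp
      show "?X + ?Y > 0" using pos by (rule add_pos_pos)
      show "((?X + ?Y)\<^sup>2 + sqrt 2 * (?X + ?Y)) * (1 - sqrt 2 * (sqrt 3 - 1) * (1 + r) / 2)
          = sqrt 2 * (sqrt 3 - 1) * (1 + r) / 2"
        by (simp add: power2_eq_square field_simps s2 s3 rr)
    qed simp
    ultimately show ?thesis by simp
  qed
  moreover have "A 4 (4 * 3) = sqrt (402 + 232 * sqrt 3 + 284 * sqrt 2 + 164 * sqrt 6)
              + sqrt (416 + 240 * sqrt 3 + 294 * sqrt 2 + 170 * sqrt 6)"
    by (rule A_4_times_4_eqI[OF _ ratio4_sqrt_3[symmetric]])
       (simp_all add: s6 power2_eq_square field_simps s2 s3)
  moreover have "A 4 28 = sqrt (2 * (64641 + 17276 * sqrt 14 + 24432 * sqrt 7 + 45708 * sqrt 2))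
              + 2 * sqrt (32384 + 22899 * sqrt 2 + 12240 * sqrt 7 + 8655 * sqrt 14)"
  proof -
    \<comment> \<open>The outer factor 2 of the second radical is moved inside as 4 to match the
      form sqrt p + sqrt q.\<close>
    have "A 4 (4 * 7) = sqrt (2 * (64641 + 17276 * sqrt 14 + 24432 * sqrt 7 + 45708 * sqrt 2))
              + sqrt (4 * (32384 + 22899 * sqrt 2 + 12240 * sqrt 7 + 8655 * sqrt 14))"
      by (rule A_4_times_4_eqI[OF _ ratio4_sqrt_7[symmetric]])
         (simp_all add: s14 power2_eq_square field_simps s2 s7)
    then show ?thesis
      unfolding real_sqrt_mult[of 4] real_sqrt_four by simp
  qed
  ultimately show ?thesis
    using assms by (simp add: add.commute)
qed

end
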